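(* Let $\Gamma_0=\coprod_{i=1}^k \Gamma_i$ be the decomposition of the subgraph $\Gamma_0 \subset \Gamma$ into its connected components, and for $i=1,\dots,k$ let $V_i\subset V$ be the linear space spanned by the simple roots $\Gamma_i^v$ corresponding to the vertices of $\Gamma_i$. Then the parabolic ideal $I_{\Gamma_0}$ is invariant under the rational Cherednik algebra $H_c$ if and only if for every $i=1,\ldots,k$ $$\sum_{\alpha \in V_i\cap \mathcal R} \frac{c_\alpha(\alpha,u)(\alpha,v)}{(\alpha,\alpha)}= (u,v)\qquad \text{for all } u,v \in V_i .$$
   Context: Let $W$ be a finite real reflection group acting by orthogonal transformations in its complexified reflection representation $V=\mathbb C^N$, with $(\cdot,\cdot)$ the standard (complex bilinear) scalar product. Let $\mathcal R$ be the corresponding Coxeter root system (real vectors, $W$-invariant set, exactly one pair $\pm\alpha$ per reflection $s_\alpha\in W$), with a chosen positive subsystem $\mathcal R_+$, and let $\Gamma$ be the Coxeter graph, whose vertices are identified with the simple roots. For a subgraph $\Gamma_0\subset\Gamma$, $\Gamma_0^v$ denotes the set of simple roots corresponding to the vertices of $\Gamma_0$; subgraphs are obtained by choosing some vertices and keeping all edges between them. Let $c:\mathcal R\to\mathbb C$, $\alpha\mapsto c_\alpha$, be a $W$-invariant function. For $\xi\in\mathbb C^N$ the Dunkl operator on $\mathbb C[x]=\mathbb C[x_1,\dots,x_N]$ is $$\nabla_\xi=\partial_\xi-\sum_{\alpha\in\mathcal R_+}\frac{c_\alpha(\alpha,\xi)}{(\alpha,x)}(1-s_\alpha),$$ where $s_\alpha$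 is the orthogonal reflection in the hyperplane $(\alpha,x)=0$. The rational Cherednik algebra $H_c$ (with $t=1$) is considered in its faithful polynomial representation: it is the algebra of operators on $\mathbb C[x]$ generated by multiplications by polynomials, the action of $W$, and all Dunkl operators $\nabla_\xi$. A subspace of $\mathbb C[x]$ is $H_c$-invariant if it is preserved by all these operators. Given $\Gamma_0\subset\Gamma$, put $\pi=\{x\in V\mid (\beta,x)=0\ \forall \beta\in\Gamma_0^v\}$. The parabolic stratum is $D_{\Gamma_0}=\bigcup_{w\in W}w(\pi)$ and the parabolic ideal is $I_{\Gamma_0}=\{p\in\mathbb C[x]\mid p|_{D_{\Gamma_0}}=0\}$. *)

theory Defs
  imports "HOL-Analysis.Analysis"
begin

definition reflection :: "real ^ 'n \<Rightarrow> real ^ 'n \<Rightarrow> real ^ 'n" where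
  "reflection a x = x - (2 * (a \<bullet> x) / (a \<bullet> a)) *\<^sub>R a"

definition reflections :: "(real ^ 'n \<Rightarrow> real ^ 'n) set" where
  "reflections = {reflection a | a. a \<noteq> 0}"

text \<open>Reflections are involutions, so the group generated by a set of reflections consists of
  the finite products of its elements.\<close>

definition finite_reflection_group :: "(real ^ 'n \<Rightarrow> real ^ 'n) set \<Rightarrow> bool" where
  "finite_reflection_group W \<longleftrightarrow>
     finite W \<and> W = {foldr (\<circ>) ss id | ss. set ss \<subseteq> W \<inter> reflections}"

definition root_system :: "(real ^ 'n \<Rightarrow> real ^ 'n) set \<Rightarrow> (real ^ 'n) set \<Rightarrow> bool" where
  "root_system W R \<longleftrightarrow>
     (\<forall>a\<in>R. a \<noteq> 0 \<and> reflection a \<in> W) \<and>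
     (\<forall>w\<in>W. w ` R \<subseteq> R) \<and>
     (\<forall>s\<in>W \<inter> reflections. \<exists>a. {b \<in> R. reflection b = s} = {a, - a})"

definition positive_system :: "(real ^ 'n) set \<Rightarrow> (real ^ 'n) set \<Rightarrow> bool" where
  "positive_system R P \<longleftrightarrow>
     (\<exists>\<rho>. (\<forall>a\<in>R. \<rho> \<bullet> a \<noteq> 0) \<and> P = {a \<in> R. 0 < \<rho> \<bullet> a})"

text \<open>The simple roots of a positive system \<open>P\<close> are uniquely determined by it.\<close>

definition simple_system :: "(real ^ 'n) set \<Rightarrow> (real ^ 'n) set \<Rightarrow> bool" where
  "simple_system P \<Delta> \<longleftrightarrow>
     \<Delta> \<subseteq> P \<and> independent \<Delta> \<and>
     (\<forall>a\<in>P. \<exists>k. (\<forall>d\<in>\<Delta>. 0 \<le> k d) \<and> a = (\<Sum>d\<in>\<Delta>. k d *\<^sub>R d))"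

definition coxeter_order :: "real ^ 'n \<Rightarrow> real ^ 'n \<Rightarrow> nat" where
  "coxeter_order a b = (LEAST m. 0 < m \<and> ((reflection a \<circ> reflection b) ^^ m) = id)"

text \<open>Edge set of the full subgraph of the Coxeter graph on the set \<open>S\<close> of simple roots, as a
  symmetric relation. The edge labels play no role for connectedness.\<close>

definition coxeter_edges :: "(real ^ 'n) set \<Rightarrow> ((real ^ 'n) \<times> (real ^ 'n)) set" where
  "coxeter_edges S = {(a, b). a \<in> S \<and> b \<in> S \<and> a \<noteq> b \<and> 3 \<le> coxeter_order a b}"

definition coxeter_components :: "(real ^ 'n) set \<Rightarrow> (real ^ 'n) set set" where
  "coxeter_components S = S // ((coxeter_edges S)\<^sup>* \<inter> S \<times> S)"

text \<open>The complex bilinear form on \<open>V\<close> is \<open>scalar_product\<close>; the operation \<open>\<bullet>\<close> on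
  \<open>complex ^ 'n\<close> is a real inner product and is not used.\<close>

definition cvec :: "real ^ 'n \<Rightarrow> complex ^ 'n" where
  "cvec a = (\<chi> i. of_real (a $ i))"

definition complexify :: "(real ^ 'n \<Rightarrow> real ^ 'n) \<Rightarrow> complex ^ 'n \<Rightarrow> complex ^ 'n" where
  "complexify w x = cvec (w (\<chi> i. Re (x $ i))) + \<i> *s cvec (w (\<chi> i. Im (x $ i)))"

text \<open>The ring \<open>\<complex>[x\<^sub>1, \<dots>, x\<^sub>N]\<close>, identified with the ring of polynomial functions on \<open>\<complex>\<^sup>N\<close>.\<close>

inductive_set polys :: "(complex ^ 'n \<Rightarrow> complex) set" where
  const: "(\<lambda>x. z) \<in> polys"
| coord: "(\<lambda>x. x $ i) \<in> polys"
| add: "p \<in> polys \<Longrightarrow> q \<in> polys \<Longrightarrow> (\<lambda>x. p x + q x) \<in> polys"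
| mult: "p \<in> polys \<Longrightarrow> q \<in> polys \<Longrightarrow> (\<lambda>x. p x * q x) \<in> polys"

definition act :: "(real ^ 'n \<Rightarrow> real ^ 'n) \<Rightarrow> (complex ^ 'n \<Rightarrow> complex) \<Rightarrow> complex ^ 'n \<Rightarrow> complex" where
  "act w p = (\<lambda>x. p (complexify (inv w) x))"

definition dir_deriv :: "complex ^ 'n \<Rightarrow> (complex ^ 'n \<Rightarrow> complex) \<Rightarrow> complex ^ 'n \<Rightarrow> complex" where
  "dir_deriv \<xi> p = (\<lambda>x. deriv (\<lambda>t. p (x + t *s \<xi>)) 0)"

text \<open>The polynomial \<open>(p - s\<^sub>\<alpha> p) / (\<alpha>, x)\<close>. It has to be taken as a quotient in the polynomial
  ring: the pointwise quotient would get the value \<open>0\<close> on the whole hyperplane \<open>(\<alpha>, x) = 0\<close>.\<close>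

definition divided_difference ::
    "real ^ 'n \<Rightarrow> (complex ^ 'n \<Rightarrow> complex) \<Rightarrow> complex ^ 'n \<Rightarrow> complex" where
  "divided_difference a p =
     (THE q. q \<in> polys \<and>
        (\<forall>x. scalar_product (cvec a) x * q x = p x - act (reflection a) p x))"

definition dunkl ::
    "(real ^ 'n) set \<Rightarrow> (real ^ 'n \<Rightarrow> complex) \<Rightarrow> complex ^ 'n \<Rightarrow>
     (complex ^ 'n \<Rightarrow> complex) \<Rightarrow> complex ^ 'n \<Rightarrow> complex" where
  "dunkl P c \<xi> p =
     (\<lambda>x. dir_deriv \<xi> p x -
        (\<Sum>a\<in>P. c a * scalar_product (cvec a) \<xi> * divided_difference a p x))"

text \<open>The rational Cherednik algebra in its polynomial representation. Its elements are used as
  operators on \<open>polys\<close> only; their values at other functions are irrelevant.\<close>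

inductive_set cherednik ::
    "(real ^ 'n \<Rightarrow> real ^ 'n) set \<Rightarrow> (real ^ 'n) set \<Rightarrow> (real ^ 'n \<Rightarrow> complex) \<Rightarrow>
     ((complex ^ 'n \<Rightarrow> complex) \<Rightarrow> complex ^ 'n \<Rightarrow> complex) set"
  for W :: "(real ^ 'n \<Rightarrow> real ^ 'n) set" and P :: "(real ^ 'n) set"
    and c :: "real ^ 'n \<Rightarrow> complex" where
  poly: "f \<in> polys \<Longrightarrow> (\<lambda>p x. f x * p x) \<in> cherednik W P c"
| group: "w \<in> W \<Longrightarrow> act w \<in> cherednik W P c"
| dunkl: "dunkl P c \<xi> \<in> cherednik W P c"
| add: "S \<in> cherednik W P c \<Longrightarrow> T \<in> cherednik W P c \<Longrightarrow>
    (\<lambda>p x. S p x + T p x) \<in> cherednik W P c"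
| comp: "S \<in> cherednik W P c \<Longrightarrow> T \<in> cherednik W P c \<Longrightarrow> S \<circ> T \<in> cherednik W P c"

definition cherednik_invariant ::
    "(real ^ 'n \<Rightarrow> real ^ 'n) set \<Rightarrow> (real ^ 'n) set \<Rightarrow> (real ^ 'n \<Rightarrow> complex) \<Rightarrow>
     (complex ^ 'n \<Rightarrow> complex) set \<Rightarrow> bool" where
  "cherednik_invariant W P c M \<longleftrightarrow> (\<forall>T\<in>cherednik W P c. T ` M \<subseteq> M)"

definition parabolic_stratum ::
    "(real ^ 'n \<Rightarrow> real ^ 'n) set \<Rightarrow> (real ^ 'n) set \<Rightarrow> (complex ^ 'n) set" where
  "parabolic_stratum W S =
     (\<Union>w\<in>W. complexify w ` {x. \<forall>b\<in>S. scalar_product (cvec b) x = 0})"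

definition parabolic_ideal ::
    "(real ^ 'n \<Rightarrow> real ^ 'n) set \<Rightarrow> (real ^ 'n) set \<Rightarrow> (complex ^ 'n \<Rightarrow> complex) set" where
  "parabolic_ideal W S = {p \<in> polys. \<forall>x\<in>parabolic_stratum W S. p x = 0}"

end

theory Submission
  imports Defs
begin

text \<open>Since \<open>I\<close> is an ideal stable under \<open>W\<close>, only the Dunkl operators matter. Let \<open>p \<in> I\<close> and let \<open>x\<close> be
  a point of a component \<open>w \<pi>\<close> of the stratum. The divided difference of \<open>p\<close> in \<open>a\<close> vanishes at \<open>x\<close>
  unless \<open>a\<close> vanishes on \<open>w \<pi>\<close>, in which case it is the normal derivative
  \<open>2 \<partial>\<^sub>a p(x) / (a, a)\<close>. Hence \<open>\<nabla>\<^sub>\<xi> p(x) = \<partial>\<^sub>\<eta> p(x)\<close> with \<open>\<eta> = \<xi> - E \<xi>\<close>, where \<open>E\<close> is the sum of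
  \<open>c\<^sub>a (a, -) a / (a, a)\<close> over the roots \<open>a\<close> vanishing on \<open>w \<pi>\<close>. The ideal contains polynomials whose
  derivative at a generic point of \<open>\<pi>\<close> detects any given direction transversal to \<open>\<pi>\<close>, so the ideal
  is invariant iff \<open>E\<close> is the identity on the span of the simple roots of \<open>\<Gamma>\<^sub>0\<close>. Every root in this
  span lies in the span of a single component, so \<open>E\<close> is block diagonal and the condition splits
  over the components.\<close>

subsection \<open>Complexification and the bilinear form\<close>

lemma scalar_product_commute: "scalar_product x y = scalar_product y (x :: 'a::comm_ring_1 ^ 'n)"
  by (simp add: scalar_product_def mult.commute)

lemma scalar_product_add_right:
  "scalar_product x (y + z) = scalar_product x y + scalar_product x (z :: 'a::comm_ring_1 ^ 'n)"
  by (simp add: scalar_product_def distrib_left sum.distrib)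

lemma scalar_product_scale_right:
  "scalar_product x (k *s y) = k * scalar_product x (y :: 'a::comm_ring_1 ^ 'n)"
  by (simp add: scalar_product_def sum_distrib_left mult.left_commute)

lemma scalar_product_zero_right: "scalar_product x (0 :: 'a::comm_ring_1 ^ 'n) = 0"
  by (simp add: scalar_product_def)

lemma scalar_product_diff_right:
  "scalar_product x (y - z) = scalar_product x y - scalar_product x (z :: 'a::comm_ring_1 ^ 'n)"
  by (simp add: scalar_product_def right_diff_distrib sum_subtractf)

lemma scalar_product_sum_right:
  "scalar_product x (\<Sum>i\<in>I. f i) = (\<Sum>i\<in>I. scalar_product x (f i :: 'a::comm_ring_1 ^ 'n))"
  by (induction I rule: infinite_finite_induct)
    (simp_all add: scalar_product_zero_right scalar_product_add_right)

lemmas scalar_product_right_simps =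
  scalar_product_add_right scalar_product_scale_right scalar_product_zero_right
  scalar_product_diff_right scalar_product_sum_right

lemma scalar_product_zero_left: "scalar_product (0 :: 'a::comm_ring_1 ^ 'n) x = 0"
  by (simp add: scalar_product_def)

text \<open>Pairing with a real vector treats real and imaginary parts separately, so complex
  orthogonality to roots becomes two real conditions.\<close>

definition re_vec :: "complex ^ 'n \<Rightarrow> real ^ 'n" where
  "re_vec x = (\<chi> i. Re (x $ i))"

definition im_vec :: "complex ^ 'n \<Rightarrow> real ^ 'n" where
  "im_vec x = (\<chi> i. Im (x $ i))"

lemma cvec_re_im: "cvec (re_vec x) + \<i> *s cvec (im_vec x) = x"
  by (simp add: cvec_def re_vec_def im_vec_def vec_eq_iff complex_eq_iff)

lemma re_vec_zero [simp]: "re_vec 0 = 0" and im_vec_zero [simp]: "im_vec 0 = 0"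
  by (simp_all add: re_vec_def im_vec_def vec_eq_iff)

lemma re_vec_of_real [simp]: "re_vec (cvec a) = a" and im_vec_of_real [simp]: "im_vec (cvec a) = 0"
  by (simp_all add: cvec_def re_vec_def im_vec_def vec_eq_iff)

lemma re_vec_cvec [simp]: "re_vec (cvec a + \<i> *s cvec b) = a"
  by (simp add: cvec_def re_vec_def vec_eq_iff)

lemma im_vec_cvec [simp]: "im_vec (cvec a + \<i> *s cvec b) = b"
  by (simp add: cvec_def im_vec_def vec_eq_iff)

lemma complexify_eq: "complexify w x = cvec (w (re_vec x)) + \<i> *s cvec (w (im_vec x))"
  by (simp add: complexify_def re_vec_def im_vec_def)

lemma cvec_add: "cvec (a + b) = cvec a + cvec b"
  by (simp add: cvec_def vec_eq_iff)

lemma cvec_diff: "cvec (a - b) = cvec a - cvec b"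
  by (simp add: cvec_def vec_eq_iff)

lemma cvec_scaleR: "cvec (k *\<^sub>R a) = of_real k *s cvec a"
  by (simp add: cvec_def vec_eq_iff)

lemma cvec_zero [simp]: "cvec 0 = 0"
  by (simp add: cvec_def vec_eq_iff)

lemma scalar_product_cvec: "scalar_product (cvec a) (cvec b) = of_real (a \<bullet> b)"
  by (simp add: scalar_product_def cvec_def inner_vec_def)

lemma scalar_product_cvec_left:
  "scalar_product (cvec a) x = of_real (a \<bullet> re_vec x) + \<i> * of_real (a \<bullet> im_vec x)"
  by (subst cvec_re_im[of x, symmetric])
    (simp add: scalar_product_right_simps scalar_product_cvec)

lemma scalar_product_cvec_eq_0_iff:
  "scalar_product (cvec a) x = 0 \<longleftrightarrow> a \<bullet> re_vec x = 0 \<and> a \<bullet> im_vec x = 0"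
  by (simp add: scalar_product_cvec_left complex_eq_iff)

lemma complexify_cvec:
  assumes "linear w"
  shows "complexify w (cvec a) = cvec (w a)"
  using linear_0[OF assms] by (simp add: complexify_eq)

lemma complexify_comp: "complexify (v \<circ> w) x = complexify v (complexify w x)"
  by (simp add: complexify_eq)

lemma complexify_id [simp]: "complexify id x = x" "complexify (\<lambda>a. a) x = x"
  by (simp_all add: complexify_eq cvec_re_im)

lemma complexify_orthogonal:
  assumes "orthogonal_transformation w"
  shows "scalar_product (cvec (w a)) (complexify w x) = scalar_product (cvec a) x"
  using assms
  by (simp add: complexify_eq scalar_product_cvec_left orthogonal_transformation_def)

lemma complexify_add:
  assumes "linear w"
  shows "complexify w (x + y) = complexify w x + complexify w y"
proof -
  have "re_vec (x + y) = re_vec x + re_vec y" "im_vec (x + y) = im_vec x + im_vec y"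
    by (simp_all add: re_vec_def im_vec_def vec_eq_iff)
  then show ?thesis
    by (simp add: complexify_eq linear_add[OF assms] cvec_add vec.scale_right_distrib)
qed

lemma complexify_scale:
  assumes "linear w"
  shows "complexify w (k *s x) = k *s complexify w x"
proof -
  have "re_vec (k *s x) = Re k *\<^sub>R re_vec x - Im k *\<^sub>R im_vec x"
    "im_vec (k *s x) = Re k *\<^sub>R im_vec x + Im k *\<^sub>R re_vec x"
    by (simp_all add: re_vec_def im_vec_def vec_eq_iff)
  then show ?thesis
    by (simp add: complexify_eq linear_add[OF assms] linear_diff[OF assms] linear_scale[OF assms])
      (simp add: cvec_def vec_eq_iff complex_eq_iff)
qed

lemma complexify_sum:
  assumes "linear w"
  shows "complexify w (\<Sum>i\<in>I. f i) = (\<Sum>i\<in>I. complexify w (f i))"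
proof (induction I rule: infinite_finite_induct)
  case (infinite I)
  then show ?case using complexify_scale[OF assms, of 0 0] by simp
next
  case empty
  then show ?case using complexify_scale[OF assms, of 0 0] by simp
next
  case (insert i I)
  then show ?case by (simp add: complexify_add[OF assms])
qed

text \<open>A complex multiple of a real vector has real multiples of it as its two parts, and
  conversely \<open>x\<close> is rebuilt from its parts. Complex spans of roots thus reduce to real
  ones.\<close>

lemma span_cvec_iff: "x \<in> vec.span (cvec ` C) \<longleftrightarrow> re_vec x \<in> span C \<and> im_vec x \<in> span C"
proof
  assume "x \<in> vec.span (cvec ` C)"
  then show "re_vec x \<in> span C \<and> im_vec x \<in> span C"
  proof (induction rule: vec.span_induct_alt)
    case base
    show ?case by (simp add: span_zero)
  next
    case (step k b y)
    then obtain a where a: "a \<in> C" "b = cvec a" by blast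
    have "re_vec (k *s b + y) = Re k *\<^sub>R a + re_vec y"
      "im_vec (k *s b + y) = Im k *\<^sub>R a + im_vec y"
      by (simp_all add: a re_vec_def im_vec_def cvec_def vec_eq_iff)
    then show ?case using step a by (simp add: span_add span_scale span_base)
  qed
next
  have *: "cvec a \<in> vec.span (cvec ` C)" if "a \<in> span C" for a
    using that
  proof (induction rule: span_induct_alt)
    case base
    then show ?case by (simp add: vec.span_zero)
  next
    case (step k b y)
    then show ?case
      by (simp add: cvec_add cvec_scaleR vec.span_add vec.span_scale vec.span_base)
  qed
  assume "re_vec x \<in> span C \<and> im_vec x \<in> span C"
  then have "cvec (re_vec x) + \<i> *s cvec (im_vec x) \<in> vec.span (cvec ` C)"
    by (intro vec.span_add vec.span_scale *) auto
  then show "x \<in> vec.span (cvec ` C)" by (simp add: cvec_re_im)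
qed

lemma cvec_in_span_iff: "cvec a \<in> vec.span (cvec ` C) \<longleftrightarrow> a \<in> span C"
  by (simp add: span_cvec_iff span_zero)

section \<open>Orthogonality to real spans and generic orthogonal points\<close>

lemma inner_span_eq_0:
  assumes "\<And>b. b \<in> C \<Longrightarrow> b \<bullet> (x :: 'a::real_inner) = 0" and "a \<in> span C"
  shows "a \<bullet> x = 0"
  using assms(2) by (induction rule: span_induct_alt) (simp_all add: assms(1) inner_add_left)

text \<open>The point is that the bilinear form is definite on the real points.\<close>

lemma span_cvec_nondegenerate:
  assumes "x \<in> vec.span (cvec ` C)" and "\<And>b. b \<in> C \<Longrightarrow> scalar_product (cvec b) x = 0"
  shows "x = 0"
proof -
  have "re_vec x \<bullet> re_vec x = 0" "im_vec x \<bullet> im_vec x = 0"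
    using assms inner_span_eq_0[of C "re_vec x" "re_vec x"] inner_span_eq_0[of C "im_vec x" "im_vec x"]
    by (simp_all add: span_cvec_iff scalar_product_cvec_eq_0_iff)
  then show ?thesis using cvec_re_im[of x] by simp
qed

lemma scalar_product_span_cvec_eq_0:
  assumes "\<And>b. b \<in> C \<Longrightarrow> scalar_product (cvec b) x = 0" and "a \<in> span C"
  shows "scalar_product (cvec a) x = 0"
  using assms inner_span_eq_0[of C "re_vec x" a] inner_span_eq_0[of C "im_vec x" a]
  by (simp add: scalar_product_cvec_eq_0_iff)

text \<open>The component of \<open>a\<close> orthogonal to \<open>span C\<close> is nonzero and
  pairs nontrivially with \<open>a\<close>.\<close>

lemma exists_orthogonal_not:
  assumes "a \<notin> span C"
  shows "\<exists>y :: 'a::euclidean_space. (\<forall>b\<in>C. b \<bullet> y = 0) \<and> a \<bullet> y \<noteq> 0"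
proof -
  obtain y z where a: "y \<in> span C" "\<And>w. w \<in> span C \<Longrightarrow> orthogonal z w" "a = y + z"
    using orthogonal_subspace_decomp_exists[of C a] by metis
  have "z \<noteq> 0" using assms a by auto
  have "y \<bullet> z = 0" using a(1,2) by (simp add: orthogonal_def inner_commute)
  then have "a \<bullet> z \<noteq> 0" using \<open>z \<noteq> 0\<close> by (simp add: a(3) inner_add_left)
  then show ?thesis
    using a(2) span_base[of _ C] by (intro exI[of _ z]) (auto simp: orthogonal_def inner_commute[of z])
qed

lemma exists_orthogonal_generic:
  fixes C A :: "'a::euclidean_space set"
  assumes "finite A" and "\<And>a. a \<in> A \<Longrightarrow> a \<notin> span C"
  shows "\<exists>y. (\<forall>b\<in>C. b \<bullet> y = 0) \<and> (\<forall>a\<in>A. a \<bullet> y \<noteq> 0)"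
  using assms
proof (induction A rule: finite_induct)
  case empty
  show ?case by (rule exI[of _ 0]) simp
next
  case (insert a A)
  obtain y where y: "\<forall>b\<in>C. b \<bullet> y = 0" "\<forall>a\<in>A. a \<bullet> y \<noteq> 0" using insert by auto
  obtain z where z: "\<forall>b\<in>C. b \<bullet> z = 0" "a \<bullet> z \<noteq> 0"
    using exists_orthogonal_not insert by (metis insertI1)
  \<comment> \<open>If \<open>b \<bullet> z\<close> is nonzero, the quotient is the only
    \<open>t\<close> at which \<open>b\<close> kills \<open>y + t z\<close>. If it is zero, then
    \<open>b\<close> is in \<open>A\<close> and its nonzero product with \<open>y\<close> is
    unchanged.\<close>
  have "finite ((\<lambda>b. - (b \<bullet> y) / (b \<bullet> z)) ` insert a A \<union> {0})" using insert by simp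
  then obtain t where t: "t \<notin> (\<lambda>b. - (b \<bullet> y) / (b \<bullet> z)) ` insert a A \<union> {0}"
    using ex_new_if_finite infinite_UNIV_char_0 by blast
  have "b \<bullet> (y + t *\<^sub>R z) \<noteq> 0" if b: "b \<in> insert a A" for b
  proof (cases "b \<bullet> z = 0")
    case True
    then have "b \<in> A" using b z by auto
    then show ?thesis using y True by (simp add: inner_add_right)
  next
    case False
    then have "t * (b \<bullet> z) \<noteq> - (b \<bullet> y)"
    proof -
      have "t \<noteq> - (b \<bullet> y) / (b \<bullet> z)" using t b by blast
      then show ?thesis using False by (metis nonzero_eq_divide_eq)
    qed
    then show ?thesis by (simp add: inner_add_right)
  qed
  moreover have "b \<bullet> (y + t *\<^sub>R z) = 0" if "b \<in> C" for b
    using y z that by (simp add: inner_add_right)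
  ultimately show ?case by blast
qed

subsection \<open>Polynomial functions\<close>

lemma polys_sum: "(\<And>i. i \<in> I \<Longrightarrow> f i \<in> polys) \<Longrightarrow> (\<lambda>x. \<Sum>i\<in>I. f i x) \<in> polys"
  by (induction I rule: infinite_finite_induct) (auto intro: polys.const polys.add)

lemma polys_prod: "(\<And>i. i \<in> I \<Longrightarrow> f i \<in> polys) \<Longrightarrow> (\<lambda>x. \<Prod>i\<in>I. f i x) \<in> polys"
  by (induction I rule: infinite_finite_induct) (auto intro: polys.const polys.mult)

lemma polys_cmult: "p \<in> polys \<Longrightarrow> (\<lambda>x. z * p x) \<in> polys"
  using polys.mult[OF polys.const] .

lemma polys_diff: "p \<in> polys \<Longrightarrow> q \<in> polys \<Longrightarrow> (\<lambda>x. p x - q x) \<in> polys"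
  using polys.add[OF _ polys_cmult[of q "-1"]] by simp

lemma polys_scalar_product: "scalar_product a \<in> polys"
  unfolding scalar_product_def[abs_def] by (intro polys_sum polys_cmult polys.coord)

lemma polys_complexify:
  assumes "linear w" and "p \<in> polys"
  shows "(\<lambda>x. p (complexify w x)) \<in> polys"
  using assms(2)
proof induction
  case (coord i)
  have "complexify w x $ i = (\<Sum>j\<in>UNIV. of_real (w (axis j 1) $ i) * x $ j)" for x
  proof -
    have "x = (\<Sum>j\<in>UNIV. (x $ j) *s cvec (axis j 1))"
      by (simp add: vec_eq_iff cvec_def axis_def if_distrib cong: if_cong)
    then have "complexify w x = complexify w (\<Sum>j\<in>UNIV. (x $ j) *s cvec (axis j 1))" by simp
    then show ?thesis
      by (simp add: complexify_sum complexify_scale complexify_cvec assms(1) mult.commute)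
        (simp add: cvec_def)
  qed
  then show ?case by (simp add: polys_sum polys_cmult polys.coord)
qed (auto intro: polys.intros)

text \<open>One vector has to serve all directions \<open>\<xi>\<close>, so that derivatives are
  linear in \<open>\<xi>\<close>; its polynomial coordinates keep directional derivatives inside the
  ring.\<close>

lemma polys_gradient:
  assumes "p \<in> polys"
  shows "\<exists>g. (\<forall>i. (\<lambda>x. g x $ i) \<in> polys) \<and>
    (\<forall>x \<xi>. ((\<lambda>t. p (x + t *s \<xi>)) has_field_derivative scalar_product (g x) \<xi>) (at 0))"
  using assms
proof induction
  case (const z)
  then show ?case
    by (intro exI[of _ "\<lambda>x. 0"]) (auto simp: scalar_product_zero_left intro: polys.const)
next
  case (coord i)
  have "((\<lambda>t. (x + t *s \<xi>) $ i) has_field_derivative scalar_product (axis i 1) \<xi>) (at 0)"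
    for x \<xi> :: "complex ^ 'a"
    by (auto simp: scalar_product_def axis_def if_distrib[of "\<lambda>u. u * _"] cong: if_cong
        intro!: derivative_eq_intros)
  then show ?case
    by (intro exI[of _ "\<lambda>x. axis i 1"]) (auto intro: polys.const)
next
  case (add p q)
  then obtain g h where g: "\<forall>i. (\<lambda>x. g x $ i) \<in> polys"
    "\<forall>x \<xi>. ((\<lambda>t. p (x + t *s \<xi>)) has_field_derivative scalar_product (g x) \<xi>) (at 0)"
    and h: "\<forall>i. (\<lambda>x. h x $ i) \<in> polys"
    "\<forall>x \<xi>. ((\<lambda>t. q (x + t *s \<xi>)) has_field_derivative scalar_product (h x) \<xi>) (at 0)"
    by blast
  show ?case
  proof (intro exI[of _ "\<lambda>x. g x + h x"] conjI allI)
    show "(\<lambda>x. (g x + h x) $ i) \<in> polys" for i using g h by (simp add: polys.add)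
    show "((\<lambda>t. p (x + t *s \<xi>) + q (x + t *s \<xi>)) has_field_derivative
        scalar_product (g x + h x) \<xi>) (at 0)" for x \<xi>
      unfolding scalar_product_commute[of "g x + h x"] scalar_product_add_right
      using g h by (auto simp: scalar_product_commute[of \<xi>] intro: DERIV_add)
  qed
next
  case (mult p q)
  then obtain g h where g: "\<forall>i. (\<lambda>x. g x $ i) \<in> polys"
    "\<forall>x \<xi>. ((\<lambda>t. p (x + t *s \<xi>)) has_field_derivative scalar_product (g x) \<xi>) (at 0)"
    and h: "\<forall>i. (\<lambda>x. h x $ i) \<in> polys"
    "\<forall>x \<xi>. ((\<lambda>t. q (x + t *s \<xi>)) has_field_derivative scalar_product (h x) \<xi>) (at 0)"
    by blast
  show ?case
  proof (intro exI[of _ "\<lambda>x. q x *s g x + p x *s h x"] conjI allI)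
    show "(\<lambda>x. (q x *s g x + p x *s h x) $ i) \<in> polys" for i
      using g h mult by (simp add: polys.add polys.mult)
    show "((\<lambda>t. p (x + t *s \<xi>) * q (x + t *s \<xi>)) has_field_derivative
        scalar_product (q x *s g x + p x *s h x) \<xi>) (at 0)" for x \<xi>
    proof -
      have "((\<lambda>t. p (x + t *s \<xi>) * q (x + t *s \<xi>)) has_field_derivative
          scalar_product (g x) \<xi> * q (x + 0 *s \<xi>) + scalar_product (h x) \<xi> * p (x + 0 *s \<xi>)) (at 0)"
        using g h by (intro DERIV_mult) auto
      then show ?thesis
        unfolding scalar_product_commute[of "q x *s g x + p x *s h x"]
        by (simp add: scalar_product_right_simps scalar_product_commute[of \<xi>] mult.commute)
    qed
  qed
qed

text \<open>The derivatives in all directions determine the vector at each \<open>x\<close>, so the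
  choice is unambiguous.\<close>

definition gradient :: "(complex ^ 'n \<Rightarrow> complex) \<Rightarrow> complex ^ 'n \<Rightarrow> complex ^ 'n" where
  "gradient p = (SOME g. (\<forall>i. (\<lambda>x. g x $ i) \<in> polys) \<and>
    (\<forall>x \<xi>. ((\<lambda>t. p (x + t *s \<xi>)) has_field_derivative scalar_product (g x) \<xi>) (at 0)))"

lemma gradient:
  assumes "p \<in> polys"
  shows polys_gradient_coord: "(\<lambda>x. gradient p x $ i) \<in> polys"
    and has_derivative_gradient:
      "((\<lambda>t. p (x + t *s \<xi>)) has_field_derivative scalar_product (gradient p x) \<xi>) (at 0)"
  using someI_ex[OF polys_gradient[OF assms], folded gradient_def] by auto

lemma dir_deriv_eq: "p \<in> polys \<Longrightarrow> dir_deriv \<xi> p x = scalar_product (gradient p x) \<xi>"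
  unfolding dir_deriv_def by (intro DERIV_imp_deriv has_derivative_gradient)

lemma polys_dir_deriv:
  assumes "p \<in> polys"
  shows "dir_deriv \<xi> p \<in> polys"
proof -
  have "dir_deriv \<xi> p = (\<lambda>x. scalar_product \<xi> (gradient p x))"
    by (simp add: dir_deriv_eq assms scalar_product_commute fun_eq_iff)
  then show ?thesis
    by (simp add: scalar_product_def polys_sum polys_cmult polys_gradient_coord assms)
qed

text \<open>The form \<open>(a, x + t y)\<close> has at most one zero \<open>t\<close> when \<open>k = (a, y)\<close> is nonzero, so it is enough
  to know the polynomial off the hyperplane \<open>(a, x) = 0\<close>, by continuity.\<close>

lemma polys_zero_by_line:
  assumes q: "q \<in> polys" and k: "k \<noteq> 0"
    and zero: "\<And>t. scalar_product a x + t * k \<noteq> 0 \<Longrightarrow> q (x + t *s y) = 0"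
  shows "q x = 0"
proof (cases "scalar_product a x = 0")
  case False
  then show ?thesis using zero[of 0] by simp
next
  case True
  have "((\<lambda>t. q (x + t *s y)) \<longlongrightarrow> q (x + 0 *s y)) (at 0)"
    using has_derivative_gradient[OF q, of x y, THEN DERIV_isCont] unfolding isCont_def .
  moreover have "((\<lambda>t. q (x + t *s y)) \<longlongrightarrow> 0) (at 0)"
  proof (rule tendsto_eventually)
    show "\<forall>\<^sub>F t in at 0. q (x + t *s y) = 0"
      unfolding eventually_at_filter using True k zero by auto
  qed
  ultimately have "q (x + 0 *s y) = 0" by (rule tendsto_unique[rotated]) simp
  then show ?thesis by simp
qed

text \<open>Along \<open>x + t a\<close> the form has slope \<open>a \<bullet> a\<close>, nonzero
  because \<open>a\<close> is real. This cancellation makes quotients by \<open>(a, x)\<close>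
  unique.\<close>

lemma polys_mult_linear_eq_0:
  assumes "q \<in> polys" and "a \<noteq> 0" and "\<And>x. scalar_product (cvec a) x * q x = 0"
  shows "q x = 0"
proof (rule polys_zero_by_line[of q "of_real (a \<bullet> a)" "cvec a" x "cvec a"])
  fix t assume "scalar_product (cvec a) x + t * of_real (a \<bullet> a) \<noteq> 0"
  then have "scalar_product (cvec a) (x + t *s cvec a) \<noteq> 0"
    by (simp add: scalar_product_right_simps scalar_product_cvec)
  then show "q (x + t *s cvec a) = 0" using assms(3) by (metis mult_eq_0_iff)
qed (use assms in auto)

subsection \<open>Reflections and divided differences\<close>

lemma linear_reflection: "linear (reflection a)"
  by (rule linearI)
    (simp_all add: reflection_def inner_add_right add_divide_distrib algebra_simps scaleR_add_left)

lemma reflection_involution: "reflection a (reflection a x) = x"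
  by (cases "a = 0") (simp_all add: reflection_def inner_diff_right algebra_simps)

lemma inv_reflection: "inv (reflection a) = reflection a"
  by (rule inv_unique_comp) (simp_all add: fun_eq_iff reflection_involution)

lemma orthogonal_reflection: "orthogonal_transformation (reflection a)"
  unfolding orthogonal_transformation_def
proof (intro conjI allI linear_reflection)
  show "reflection a x \<bullet> reflection a y = x \<bullet> y" for x y
    by (cases "a = 0") (simp_all add: reflection_def inner_diff_right inner_diff_left
        inner_commute field_simps)
qed

lemma complexify_reflection:
  "complexify (reflection a) x =
    x - (2 * scalar_product (cvec a) x / of_real (a \<bullet> a)) *s cvec a"
  by (subst (2) cvec_re_im[of x, symmetric])
    (simp add: complexify_eq reflection_def scalar_product_cvec_left cvec_diff cvec_scaleR
      vec_eq_iff algebra_simps add_divide_distrib)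

lemma act_reflection: "act (reflection a) p x = p (complexify (reflection a) x)"
  by (simp add: act_def inv_reflection)

text \<open>Structural induction replaces polynomial division. Coordinates have constant quotients,
  and products follow the twisted Leibniz rule
  \<open>p q - s p s q = (p - s p) q + s p (q - s q)\<close>.\<close>

lemma divided_difference_exists:
  assumes "p \<in> polys"
  shows "\<exists>q\<in>polys. \<forall>x. scalar_product (cvec a) x * q x = p x - act (reflection a) p x"
  using assms
proof induction
  case (const z)
  show ?case by (rule bexI[OF _ polys.const[of 0]]) (simp add: act_def)
next
  case (coord i)
  show ?case
    by (rule bexI[OF _ polys.const[of "2 / of_real (a \<bullet> a) * of_real (a $ i)"]])
      (simp add: act_reflection complexify_reflection cvec_def)
next
  case (add p1 p2)
  then obtain q1 q2 where q: "q1 \<in> polys" "q2 \<in> polys"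
    "\<forall>x. scalar_product (cvec a) x * q1 x = p1 x - act (reflection a) p1 x"
    "\<forall>x. scalar_product (cvec a) x * q2 x = p2 x - act (reflection a) p2 x"
    by blast
  show ?case
    by (rule bexI[OF _ polys.add[OF q(1,2)]]) (use q(3,4) in \<open>simp add: act_def distrib_left\<close>)
next
  case (mult p1 p2)
  then obtain q1 q2 where q: "q1 \<in> polys" "q2 \<in> polys"
    "\<forall>x. scalar_product (cvec a) x * q1 x = p1 x - act (reflection a) p1 x"
    "\<forall>x. scalar_product (cvec a) x * q2 x = p2 x - act (reflection a) p2 x"
    by blast
  have "act (reflection a) p1 \<in> polys"
    using polys_complexify[OF linear_reflection mult(1)] by (simp add: act_reflection[abs_def])
  then have "(\<lambda>x. q1 x * p2 x + act (reflection a) p1 x * q2 x) \<in> polys"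
    using q mult by (intro polys.intros)
  then show ?case
  proof (rule bexI[rotated], intro allI)
    fix x
    have "scalar_product (cvec a) x * (q1 x * p2 x + act (reflection a) p1 x * q2 x) =
      (scalar_product (cvec a) x * q1 x) * p2 x + act (reflection a) p1 x * (scalar_product (cvec a) x * q2 x)"
      by (simp add: algebra_simps)
    also have "\<dots> = p1 x * p2 x - act (reflection a) (\<lambda>x. p1 x * p2 x) x"
      unfolding q(3,4)[rule_format] by (simp add: act_def algebra_simps)
    finally show "scalar_product (cvec a) x * (q1 x * p2 x + act (reflection a) p1 x * q2 x) =
      p1 x * p2 x - act (reflection a) (\<lambda>x. p1 x * p2 x) x" .
  qed
qed

lemma divided_difference:
  assumes "p \<in> polys" and "a \<noteq> 0"
  shows polys_divided_difference: "divided_difference a p \<in> polys"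
    and divided_difference_mult:
      "scalar_product (cvec a) x * divided_difference a p x = p x - act (reflection a) p x"
proof -
  let ?Q = "\<lambda>q. q \<in> polys \<and> (\<forall>x. scalar_product (cvec a) x * q x = p x - act (reflection a) p x)"
  have "\<exists>!q. ?Q q"
  proof (rule ex_ex1I)
    show "\<exists>q. ?Q q" using divided_difference_exists[OF assms(1)] by blast
    fix q r assume qr: "?Q q" "?Q r"
    have "q x - r x = 0" for x
      using qr assms(2) by (intro polys_mult_linear_eq_0[of "\<lambda>x. q x - r x" a] polys_diff)
        (auto simp: right_diff_distrib)
    then show "q = r" by (simp add: fun_eq_iff)
  qed
  from theI'[OF this] show "divided_difference a p \<in> polys"
    "scalar_product (cvec a) x * divided_difference a p x = p x - act (reflection a) p x"
    unfolding divided_difference_def by auto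
qed

text \<open>The reflection turns \<open>t\<close> into \<open>-t\<close> on the line
  \<open>x + t a\<close>, so the defining identity reads
  \<open>t (a, a) q = p(x + t a) - p(x - t a)\<close>. Comparing derivatives at \<open>t = 0\<close>
  gives the value.\<close>

lemma divided_difference_on_mirror:
  assumes p: "p \<in> polys" and a: "a \<noteq> 0" and x: "scalar_product (cvec a) x = 0"
  shows "divided_difference a p x = 2 * scalar_product (gradient p x) (cvec a) / of_real (a \<bullet> a)"
proof -
  let ?q = "divided_difference a p" and ?n = "of_real (a \<bullet> a) :: complex"
  have n: "?n \<noteq> 0" using a by simp
  have cont: "((\<lambda>t. ?q (x + t *s cvec a)) \<longlongrightarrow> ?q x) (at 0)"
    using has_derivative_gradient[OF polys_divided_difference[OF p a], of x "cvec a", THEN DERIV_isCont]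
    by (simp add: isCont_def)
  have eq: "t * ?n * ?q (x + t *s cvec a) = p (x + t *s cvec a) - p (x + t *s (- cvec a))" for t
  proof -
    have "scalar_product (cvec a) (x + t *s cvec a) = t * ?n"
      by (simp add: scalar_product_right_simps scalar_product_cvec x)
    moreover have "complexify (reflection a) (x + t *s cvec a) = x + t *s (- cvec a)"
      unfolding complexify_reflection calculation using a by (simp add: vec.scale_minus_right flip: vec.scale_left_diff_distrib)
    ultimately show ?thesis
      using divided_difference_mult[OF p a, of "x + t *s cvec a"] by (simp add: act_reflection)
  qed
  have "((\<lambda>t. t * ?n * ?q (x + t *s cvec a)) has_field_derivative
      scalar_product (gradient p x) (cvec a) - scalar_product (gradient p x) (- cvec a)) (at 0)"
    unfolding eq by (intro DERIV_diff has_derivative_gradient p)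
  moreover have "scalar_product (gradient p x) (- cvec a) = - scalar_product (gradient p x) (cvec a)"
    using scalar_product_scale_right[of "gradient p x" "-1" "cvec a"] by simp
  ultimately have D: "((\<lambda>t. t * ?n * ?q (x + t *s cvec a)) has_field_derivative
      2 * scalar_product (gradient p x) (cvec a)) (at 0)" by simp
  \<comment> \<open>The derivative at 0 is a limit of difference quotients, in which the factor
    \<open>t\<close> cancels; this needs only continuity of the quotient polynomial.\<close>
  have "((\<lambda>t. ?n * ?q (x + t *s cvec a)) \<longlongrightarrow> 2 * scalar_product (gradient p x) (cvec a)) (at 0)"
  proof (rule Lim_transform_eventually)
    show "((\<lambda>t. (t * ?n * ?q (x + t *s cvec a) - 0 * ?n * ?q (x + 0 *s cvec a)) / (t - 0)) \<longlongrightarrow>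
        2 * scalar_product (gradient p x) (cvec a)) (at 0)"
      using D unfolding has_field_derivative_iff .
    show "\<forall>\<^sub>F t in at 0. (t * ?n * ?q (x + t *s cvec a) - 0 * ?n * ?q (x + 0 *s cvec a)) / (t - 0) =
        ?n * ?q (x + t *s cvec a)"
      unfolding eventually_at_filter by simp
  qed
  moreover have "((\<lambda>t. ?n * ?q (x + t *s cvec a)) \<longlongrightarrow> ?n * ?q x) (at 0)"
    by (intro tendsto_intros cont)
  ultimately have "?n * ?q x = 2 * scalar_product (gradient p x) (cvec a)"
    by (rule LIM_unique[rotated])
  then show ?thesis using n by (simp add: field_simps)
qed

subsection \<open>Finite reflection groups and their roots\<close>

lemma foldr_comp_append:
  "foldr (\<circ>) (xs @ ys) id = foldr (\<circ>) xs id \<circ> foldr (\<circ>) ys id"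
  by (induction xs) (simp_all add: o_assoc)

lemma reflection_comp_self: "s \<in> reflections \<Longrightarrow> s \<circ> s = id"
  by (auto simp: reflections_def reflection_involution)

text \<open>The two innermost factors cancel, since a reflection squares to the identity. Reversing
  a word therefore inverts it.\<close>

lemma foldr_comp_rev_reflections:
  assumes "set ss \<subseteq> reflections"
  shows "foldr (\<circ>) (rev ss) id \<circ> foldr (\<circ>) ss id = id"
  using assms
proof (induction ss)
  case (Cons s ss)
  have "foldr (\<circ>) (rev (s # ss)) id \<circ> foldr (\<circ>) (s # ss) id =
      foldr (\<circ>) (rev ss) id \<circ> (s \<circ> s) \<circ> foldr (\<circ>) ss id"
    by (simp add: foldr_comp_append o_assoc del: foldr_append)
  also have "\<dots> = foldr (\<circ>) (rev ss) id \<circ> foldr (\<circ>) ss id"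
    using Cons.prems by (simp only: reflection_comp_self[of s] list.set insert_subset comp_id)
  also have "\<dots> = id" using Cons.prems by (intro Cons.IH) simp
  finally show ?case .
qed simp

lemma orthogonal_foldr_reflections:
  "set ss \<subseteq> reflections \<Longrightarrow> orthogonal_transformation (foldr (\<circ>) ss id)"
proof (induction ss)
  case Nil
  then show ?case using orthogonal_transformation_id by (simp add: id_def)
next
  case (Cons s ss)
  then obtain a where "s = reflection a" by (auto simp: reflections_def)
  moreover have "foldr (\<circ>) (s # ss) id = s \<circ> foldr (\<circ>) ss id" by simp
  moreover have "orthogonal_transformation (foldr (\<circ>) ss id)"
    using Cons.prems by (intro Cons.IH) simp
  ultimately show ?case
    using orthogonal_transformation_compose[OF orthogonal_reflection] by metis
qed

text \<open>Solving the equation for \<open>y\<close> leaves a multiple of \<open>a\<close>. This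
  later turns relations between two reflections into statements about lines.\<close>

lemma reflection_eq_minus_in_span:
  assumes "reflection a y = - y"
  shows "y \<in> span {a}"
proof -
  have "2 *\<^sub>R y = (2 * (a \<bullet> y) / (a \<bullet> a)) *\<^sub>R a"
    using assms by (simp add: reflection_def scaleR_2 algebra_simps)
  then have "(1 / 2) *\<^sub>R 2 *\<^sub>R y \<in> span {a}"
    by (metis span_base span_scale singletonI)
  then show ?thesis by simp
qed

lemma span_scale_cancel:
  assumes "k *\<^sub>R b \<in> span C" and "b \<notin> span C"
  shows "k = 0"
proof (rule ccontr)
  assume "k \<noteq> 0"
  have "inverse k *\<^sub>R k *\<^sub>R b \<in> span C" using assms(1) by (rule span_scale)
  then show False using \<open>k \<noteq> 0\<close> assms(2) by simp
qed

lemma reflection_self: "reflection a a = - a"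
  by (cases "a = 0") (simp_all add: reflection_def scaleR_2)

locale reflection_group_setting =
  fixes W :: "(real ^ 'n \<Rightarrow> real ^ 'n) set"
    and R P \<Delta> S :: "(real ^ 'n) set"
    and c :: "real ^ 'n \<Rightarrow> complex"
  assumes refl_group: "finite_reflection_group W"
    and roots: "root_system W R"
    and positive: "positive_system R P"
    and simple: "simple_system P \<Delta>"
    and S_subset: "S \<subseteq> \<Delta>"
    and c_invariant: "\<And>w a. w \<in> W \<Longrightarrow> a \<in> R \<Longrightarrow> c (w a) = c a"
begin

section \<open>The finite group generated by reflections\<close>

lemma finite_W: "finite W"
  using refl_group by (simp add: finite_reflection_group_def)

lemma W_iff: "w \<in> W \<longleftrightarrow> (\<exists>ss. w = foldr (\<circ>) ss id \<and> set ss \<subseteq> W \<inter> reflections)"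
proof -
  have "W = {foldr (\<circ>) ss id | ss. set ss \<subseteq> W \<inter> reflections}"
    using refl_group unfolding finite_reflection_group_def by (rule conjunct2)
  then have "w \<in> W \<longleftrightarrow> w \<in> {foldr (\<circ>) ss id | ss. set ss \<subseteq> W \<inter> reflections}"
    by (rule arg_cong)
  then show ?thesis unfolding mem_Collect_eq .
qed

lemma id_in_W: "id \<in> W"
  unfolding W_iff by (rule exI[of _ "[]"]) simp

lemma comp_in_W:
  assumes "v \<in> W" "w \<in> W"
  shows "v \<circ> w \<in> W"
proof -
  obtain xs ys where "v = foldr (\<circ>) xs id" "set xs \<subseteq> W \<inter> reflections"
    "w = foldr (\<circ>) ys id" "set ys \<subseteq> W \<inter> reflections"
    using assms W_iff by meson
  then show ?thesis
    unfolding W_iff[of "v \<circ> w"] by (intro exI[of _ "xs @ ys"]) (simp add: foldr_comp_append del: foldr_append)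
qed

lemma orthogonal_W: "w \<in> W \<Longrightarrow> orthogonal_transformation w"
  using W_iff[of w] orthogonal_foldr_reflections by fastforce

lemma linear_W: "w \<in> W \<Longrightarrow> linear w"
  using orthogonal_W orthogonal_transformation_linear by blast

lemma bij_W: "w \<in> W \<Longrightarrow> bij w"
  using orthogonal_W orthogonal_transformation_bij by blast

lemma inj_W: "w \<in> W \<Longrightarrow> inj w"
  using bij_W bij_is_inj by blast

lemma inv_in_W:
  assumes "w \<in> W"
  shows "inv w \<in> W"
proof -
  obtain ss where ss: "w = foldr (\<circ>) ss id" "set ss \<subseteq> W \<inter> reflections"
    using assms W_iff by blast
  let ?v = "foldr (\<circ>) (rev ss) id"
  have "?v \<circ> w = id" "w \<circ> ?v = id"
    using ss foldr_comp_rev_reflections[of ss] foldr_comp_rev_reflections[of "rev ss"] by auto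
  then have "inv w = ?v" by (rule inv_unique_comp[rotated])
  then show ?thesis unfolding W_iff[of "inv w"] using ss by (intro exI[of _ "rev ss"]) simp
qed

lemma W_inv_apply: "w \<in> W \<Longrightarrow> w (inv w a) = a"
  using bij_W bij_is_surj surj_f_inv_f by metis

lemma complexify_W_inv: "w \<in> W \<Longrightarrow> complexify w (complexify (inv w) x) = x"
  using complexify_comp[of w "inv w" x] W_inv_apply[of w] by (simp add: o_def)

text \<open>Two powers of \<open>w\<close> coincide because \<open>W\<close> is finite, and
  injectivity cancels the smaller one. Hence the minimum in \<open>coxeter_order\<close> is attained
  for roots.\<close>

lemma W_finite_order:
  assumes "w \<in> W"
  shows "\<exists>m>0. w ^^ m = id"
proof -
  have pow: "w ^^ n \<in> W" for n
    using assms by (induction n) (auto intro: comp_in_W id_in_W)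
  then have "finite (range (\<lambda>n. w ^^ n))" using finite_W by (auto intro: finite_subset)
  then have "\<not> inj (\<lambda>n. w ^^ n)" using finite_imageD infinite_UNIV_nat by blast
  then obtain i j where ij: "i < j" "w ^^ i = w ^^ j"
    unfolding inj_def by (metis nat_neq_iff)
  then have "w ^^ i = w ^^ i \<circ> w ^^ (j - i)"
    by (metis funpow_add le_add_diff_inverse less_imp_le)
  then have "(w ^^ i) (x) = (w ^^ i) ((w ^^ (j - i)) x)" for x by (metis comp_apply)
  then have "w ^^ (j - i) = id"
    using inj_W[OF pow[of i]] by (metis (no_types) eq_id_iff injD)
  then show ?thesis using ij by (metis zero_less_diff)
qed

section \<open>Roots and their signs\<close>

lemma root_nonzero: "a \<in> R \<Longrightarrow> a \<noteq> 0"
  and reflection_in_W: "a \<in> R \<Longrightarrow> reflection a \<in> W"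
  and W_root: "w \<in> W \<Longrightarrow> a \<in> R \<Longrightarrow> w a \<in> R"
proof -
  have "\<forall>a\<in>R. a \<noteq> 0 \<and> reflection a \<in> W" "\<forall>w\<in>W. w ` R \<subseteq> R"
    using roots by (simp_all add: root_system_def)
  then show "a \<in> R \<Longrightarrow> a \<noteq> 0" "a \<in> R \<Longrightarrow> reflection a \<in> W" "w \<in> W \<Longrightarrow> a \<in> R \<Longrightarrow> w a \<in> R"
    by auto
qed

lemma minus_root: "a \<in> R \<Longrightarrow> - a \<in> R"
  using W_root[OF reflection_in_W, of a a] by (simp add: reflection_self)

lemma c_minus: "a \<in> R \<Longrightarrow> c (- a) = c a"
  using c_invariant[OF reflection_in_W, of a a] by (simp add: reflection_self)

text \<open>The roots lie over the finitely many reflections of \<open>W\<close>, and each fibre is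
  a pair \<open>{a, - a}\<close>.\<close>

lemma finite_R: "finite R"
proof -
  have "R \<subseteq> (\<Union>s\<in>W \<inter> reflections. {b \<in> R. reflection b = s})"
    using root_nonzero reflection_in_W by (auto simp: reflections_def)
  moreover have "finite {b \<in> R. reflection b = s}" if "s \<in> W \<inter> reflections" for s
  proof -
    have "\<exists>a. {b \<in> R. reflection b = s} = {a, - a}"
      using roots that by (simp add: root_system_def)
    then show ?thesis by (metis finite.emptyI finite_insert)
  qed
  ultimately show ?thesis using finite_W by (meson finite_Int finite_UN_I finite_subset)
qed

lemma P_subset: "P \<subseteq> R"
  and P_cases: "a \<in> R \<Longrightarrow> a \<in> P \<or> - a \<in> P"
  and P_disjoint: "a \<in> P \<Longrightarrow> - a \<notin> P"
proof -
  obtain \<rho> where \<rho>: "\<forall>a\<in>R. \<rho> \<bullet> a \<noteq> 0" "P = {a \<in> R. 0 < \<rho> \<bullet> a}"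
    using positive unfolding positive_system_def by blast
  show "P \<subseteq> R" "a \<in> P \<Longrightarrow> - a \<notin> P" using \<rho>(2) by auto
  show "a \<in> P \<or> - a \<in> P" if "a \<in> R"
    using \<rho>(1)[rule_format, OF that] minus_root[OF that] that by (auto simp: \<rho>(2))
qed

lemma finite_P: "finite P"
  using finite_R P_subset finite_subset by blast

lemma independent_\<Delta>: "independent \<Delta>" and \<Delta>_subset: "\<Delta> \<subseteq> P"
  using simple by (auto simp: simple_system_def)

lemma finite_\<Delta>: "finite \<Delta>"
  using finite_P \<Delta>_subset finite_subset by blast

lemma S_root: "b \<in> S \<Longrightarrow> b \<in> R"
  using S_subset \<Delta>_subset P_subset by blast

text \<open>Dunkl operators sum over positive roots, the criterion over all roots. The factor 2
  matches the one in the value of a divided difference on its mirror.\<close>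

lemma sum_roots_eq_twice_positive:
  fixes f :: "real ^ 'n \<Rightarrow> 'b::comm_ring_1"
  assumes "\<And>a. a \<in> R \<Longrightarrow> f (- a) = f a"
  shows "(\<Sum>a\<in>{a \<in> R. a \<in> span C}. f a) = 2 * (\<Sum>a\<in>{a \<in> P. a \<in> span C}. f a)"
proof -
  let ?Q = "{a \<in> P. a \<in> span C}"
  have "{a \<in> R. a \<in> span C} = ?Q \<union> uminus ` ?Q"
  proof safe
    fix a assume a: "a \<in> R" "a \<in> span C" "a \<notin> uminus ` ?Q"
    have "- a \<notin> P"
    proof
      assume "- a \<in> P"
      then have "- a \<in> ?Q" using a by (simp add: span_neg)
      then have "- (- a) \<in> uminus ` ?Q" by blast
      then show False using a by simp
    qed
    then show "a \<in> P" using P_cases a by blast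
  qed (use P_subset minus_root span_neg in auto)
  moreover have "?Q \<inter> uminus ` ?Q = {}" using P_disjoint by auto
  moreover have "(\<Sum>a\<in>uminus ` ?Q. f a) = (\<Sum>a\<in>?Q. f a)"
    using assms P_subset by (subst sum.reindex) (auto intro!: sum.cong simp: inj_on_def)
  ultimately show ?thesis using finite_P by (simp add: sum.union_disjoint)
qed

subsection \<open>Roots in the span of a subgraph\<close>

lemma positive_root_coords:
  assumes "a \<in> P"
  shows "a \<in> span \<Delta>" and "0 \<le> representation \<Delta> a d"
proof -
  obtain k where k: "\<forall>d\<in>\<Delta>. 0 \<le> k d" "a = (\<Sum>d\<in>\<Delta>. k d *\<^sub>R d)"
    using simple assms unfolding simple_system_def by blast
  show "a \<in> span \<Delta>" unfolding k(2) by (intro span_sum span_scale span_base)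
  have "representation \<Delta> a d = (\<Sum>e\<in>\<Delta>. k e * (if d = e then 1 else 0))"
    unfolding k(2)
    by (simp add: representation_sum independent_\<Delta> span_base span_scale representation_scale
        representation_basis)
  also have "\<dots> \<ge> 0" using k(1) by (intro sum_nonneg) auto
  finally show "0 \<le> representation \<Delta> a d" .
qed

lemma root_in_span: "a \<in> R \<Longrightarrow> a \<in> span \<Delta>"
  using P_cases positive_root_coords(1) span_neg by (metis minus_minus)

lemma span_subset_simple_iff:
  assumes "T \<subseteq> \<Delta>"
  shows "v \<in> span T \<longleftrightarrow> v \<in> span \<Delta> \<and> (\<forall>d\<in>\<Delta> - T. representation \<Delta> v d = 0)"
proof (intro iffI conjI ballI)
  assume v: "v \<in> span T"
  then show "v \<in> span \<Delta>" using span_mono[OF assms] by blast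
  show "representation \<Delta> v d = 0" if "d \<in> \<Delta> - T" for d
    using representation_extend[OF independent_\<Delta> v assms] representation_ne_zero[of T v d] that
    by auto
next
  assume v: "v \<in> span \<Delta> \<and> (\<forall>d\<in>\<Delta> - T. representation \<Delta> v d = 0)"
  have "(\<Sum>d\<in>\<Delta>. representation \<Delta> v d *\<^sub>R d) \<in> span T"
  proof (rule span_sum)
    show "representation \<Delta> v d *\<^sub>R d \<in> span T" if "d \<in> \<Delta>" for d
      using v that by (cases "d \<in> T") (auto intro: span_scale span_base span_zero)
  qed
  then show "v \<in> span T"
    using sum_representation_eq[OF independent_\<Delta> _ finite_\<Delta>, of v] v by simp
qed

text \<open>The reflection in a simple root \<open>d\<close> with \<open>d \<bullet> a > 0\<close> lowers a root \<open>a\<close> with respect to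
  \<open>\<rho>\<close>, and it keeps \<open>a\<close> positive because it changes only one coordinate. So a lowest root outside
  both spans has its reflection in one of the spans; comparing coordinates shows that this is
  impossible.\<close>

lemma positive_root_in_summand:
  assumes C: "C \<subseteq> S" and orth: "\<And>a b. a \<in> C \<Longrightarrow> b \<in> S - C \<Longrightarrow> a \<bullet> b = 0"
    and a: "a \<in> P" "a \<in> span S"
  shows "a \<in> span C \<or> a \<in> span (S - C)"
proof (rule ccontr)
  assume not: "\<not> ?thesis"
  obtain \<rho> where \<rho>: "P = {a \<in> R. 0 < \<rho> \<bullet> a}"
    using positive unfolding positive_system_def by blast
  let ?B = "{a \<in> P. a \<in> span S \<and> a \<notin> span C \<and> a \<notin> span (S - C)}"
  have "finite ?B" "?B \<noteq> {}" using finite_P a not by auto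
  then obtain a where "is_arg_min (\<lambda>a. \<rho> \<bullet> a) (\<lambda>a. a \<in> ?B) a"
    using ex_is_arg_min_if_finite by blast
  then have aB: "a \<in> ?B" and min: "\<And>b. b \<in> ?B \<Longrightarrow> \<rho> \<bullet> a \<le> \<rho> \<bullet> b"
    by (auto simp: is_arg_min_linorder)
  let ?k = "representation \<Delta>"
  have aP: "a \<in> P" and aS: "a \<in> span S" using aB by auto
  have a\<Delta>: "a \<in> span \<Delta>" and k_nonneg: "\<And>d. 0 \<le> ?k a d"
    using positive_root_coords[OF aP] by auto
  have "a \<noteq> 0" using aP P_subset root_nonzero by blast
  \<comment> \<open>Expanding one factor of \<open>a \<bullet> a > 0\<close> in simple roots, with
    nonnegative coordinates, exposes a simple root \<open>d\<close> in the support of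
    \<open>a\<close> with \<open>d \<bullet> a > 0\<close>.\<close>
  have "(\<Sum>d\<in>\<Delta>. ?k a d * (d \<bullet> a)) = (\<Sum>d\<in>\<Delta>. ?k a d *\<^sub>R d) \<bullet> a"
    by (simp add: inner_sum_left)
  also have "\<dots> = a \<bullet> a"
    by (simp only: sum_representation_eq[OF independent_\<Delta> a\<Delta> finite_\<Delta> subset_refl])
  also have "\<dots> > 0" using \<open>a \<noteq> 0\<close> by simp
  finally have "\<not> (\<Sum>d\<in>\<Delta>. ?k a d * (d \<bullet> a)) \<le> 0" by simp
  then obtain d where d: "d \<in> \<Delta>" "0 < ?k a d * (d \<bullet> a)"
    using sum_nonpos[of \<Delta> "\<lambda>d. ?k a d * (d \<bullet> a)"] by force
  then have da: "0 < d \<bullet> a" and kd: "?k a d \<noteq> 0"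
    using k_nonneg[of d] by (auto simp: zero_less_mult_iff)
  have dS: "d \<in> S"
    using kd d(1) aS span_subset_simple_iff[OF S_subset, of a] by blast
  have d0: "0 < d \<bullet> d" and d\<rho>: "0 < \<rho> \<bullet> d" and dR: "d \<in> R"
  proof -
    have "d \<in> P" using d(1) \<Delta>_subset by blast
    then show "0 < \<rho> \<bullet> d" "d \<in> R" using \<rho> by auto
    then show "0 < d \<bullet> d" using root_nonzero by simp
  qed
  let ?m = "2 * (d \<bullet> a) / (d \<bullet> d)"
  let ?b = "reflection d a"
  have m: "0 < ?m" using da d0 by simp
  have b: "?b = a - ?m *\<^sub>R d" by (simp add: reflection_def)
  have bR: "?b \<in> R" using W_root[OF reflection_in_W[OF dR], of a] aP P_subset by blast
  have bS: "?b \<in> span S" unfolding b using aS dS by (simp add: span_diff span_scale span_base)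
  have "\<rho> \<bullet> ?b < \<rho> \<bullet> a" unfolding b using mult_pos_pos[OF m d\<rho>] by (simp add: inner_diff_right)
  then have bB: "?b \<notin> ?B" using min by force
  \<comment> \<open>Reflection in \<open>d\<close> reverses the sign of the product with
    \<open>d\<close>. This will exclude the summand orthogonal to \<open>d\<close>.\<close>
  have db: "d \<bullet> ?b \<noteq> 0" unfolding b using da d0 by (simp add: inner_diff_right)
  \<comment> \<open>Stated for a summand \<open>D\<close> containing \<open>d\<close>, so as to
    serve for both \<open>C\<close> and \<open>S - C\<close>.\<close>
  have contradiction: False if D: "D \<subseteq> S" "d \<in> D" "a \<notin> span D"
    and orthD: "\<And>a b. a \<in> D \<Longrightarrow> b \<in> S - D \<Longrightarrow> a \<bullet> b = 0"
    and cases: "?b \<in> P \<Longrightarrow> ?b \<in> span D \<or> ?b \<in> span (S - D)" for D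
  proof -
    have D\<Delta>: "D \<subseteq> \<Delta>" using D(1) S_subset by blast
    \<comment> \<open>The reflection in \<open>d\<close> changes only the coordinate at
      \<open>d\<close>, so the positive coordinate at \<open>e\<close> survives in
      \<open>?b\<close>. It makes \<open>?b\<close> positive and keeps it out of
      \<open>span D\<close>.\<close>
    obtain e where e: "e \<in> \<Delta> - D" "?k a e \<noteq> 0"
      using D(3) span_subset_simple_iff[OF D\<Delta>, of a] a\<Delta> by blast
    have "?k a e > 0" using e(2) k_nonneg[of e] by simp
    moreover have "?k ?b e = ?k a e"
    proof -
      have "d \<in> span \<Delta>" "e \<noteq> d" using d(1) e D(2) by (auto intro: span_base)
      then show ?thesis
        unfolding b
        by (simp add: representation_diff[OF independent_\<Delta> a\<Delta>] representation_scale[OF independent_\<Delta>]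
            representation_diff[OF independent_\<Delta> _ a\<Delta>]
            representation_basis[OF independent_\<Delta> d(1)] span_scale)
    qed
    ultimately have be: "?k ?b e > 0" by simp
    have "- ?b \<notin> P"
    proof
      assume "- ?b \<in> P"
      from positive_root_coords(2)[OF this, of e] show False
        using be representation_neg[OF independent_\<Delta> root_in_span[OF bR]] by simp
    qed
    then have "?b \<in> P" using P_cases bR by blast
    moreover have "?b \<notin> span D"
      using be e(1) span_subset_simple_iff[OF D\<Delta>, of ?b] by force
    moreover have "?b \<notin> span (S - D)"
    proof
      assume "?b \<in> span (S - D)"
      then have "?b \<bullet> d = 0"
        by (rule inner_span_eq_0[rotated]) (use orthD[OF D(2)] in \<open>simp add: inner_commute[of _ d]\<close>)
      then show False using db by (simp add: inner_commute)
    qed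
    ultimately show False using cases by blast
  qed
  have bcases: "?b \<in> P \<Longrightarrow> ?b \<in> span C \<or> ?b \<in> span (S - C)" using bB bS by blast
  show False
  proof (cases "d \<in> C")
    case True
    show False
      by (rule contradiction[of C, OF C True _ orth bcases]) (use aB in blast)+
  next
    case False
    have SC: "S - (S - C) = C" using C by blast
    have orth': "x \<bullet> y = 0" if "x \<in> S - C" "y \<in> S - (S - C)" for x y
      using orth[of y x] that unfolding SC by (simp add: inner_commute)
    have bcases': "?b \<in> P \<Longrightarrow> ?b \<in> span (S - C) \<or> ?b \<in> span (S - (S - C))"
      unfolding SC using bcases by blast
    show False
      by (rule contradiction[of "S - C", OF _ _ _ orth' bcases']) (use dS False aB in blast)+
  qed
qed

lemma root_in_summand:
  assumes C: "C \<subseteq> S" and orth: "\<And>a b. a \<in> C \<Longrightarrow> b \<in> S - C \<Longrightarrow> a \<bullet> b = 0"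
    and a: "a \<in> R" "a \<in> span S"
  shows "a \<in> span C \<or> a \<in> span (S - C)"
  using P_cases[OF a(1)]
proof
  assume "- a \<in> P"
  then have "- a \<in> span C \<or> - a \<in> span (S - C)"
    using positive_root_in_summand[OF C orth] a(2) span_neg by blast
  then show ?thesis using span_neg by (metis minus_minus)
qed (use positive_root_in_summand[OF C orth] a(2) in blast)

text \<open>The product of the reflections has order 1 or 2. Order 1 puts \<open>b\<close> on the
  line of \<open>a\<close>, against independence. Order 2 makes the reflections commute, which puts
  \<open>reflection b a\<close> on that line, so its component along \<open>b\<close>
  vanishes.\<close>

lemma nonadjacent_orthogonal:
  assumes "a \<in> S" "b \<in> S" "a \<noteq> b" "(a, b) \<notin> coxeter_edges S"
  shows "a \<bullet> b = 0"
proof -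
  let ?t = "reflection a \<circ> reflection b"
  have indep: "b \<notin> span {a}"
  proof
    assume b: "b \<in> span {a}"
    have "{a} \<subseteq> \<Delta> - {b}" using assms S_subset by auto
    then have "b \<in> span (\<Delta> - {b})" using b span_mono by blast
    moreover have "b \<in> \<Delta>" using assms S_subset by blast
    ultimately show False using independent_\<Delta> unfolding dependent_def by blast
  qed
  have "?t \<in> W" using assms(1,2) by (intro comp_in_W reflection_in_W S_root)
  then have order: "0 < coxeter_order a b \<and> ?t ^^ coxeter_order a b = id"
    unfolding coxeter_order_def by (rule LeastI_ex[OF W_finite_order])
  have "coxeter_order a b < 3" using assms by (auto simp: coxeter_edges_def)
  with order have "coxeter_order a b = 1 \<or> coxeter_order a b = 2" by linarith
  with order consider "?t ^^ 1 = id" | "?t ^^ 2 = id" by metis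
  then show ?thesis
  proof cases
    case 1
    then have "?t b = b" by simp
    then have "reflection a (- b) = b" by (simp add: reflection_self)
    then have "reflection a b = - b" using reflection_involution[of a "- b"] by simp
    then show ?thesis using reflection_eq_minus_in_span indep by blast
  next
    case 2
    then have "(?t ^^ 2) a = a" by simp
    then have "reflection a (reflection b (reflection a (reflection b a))) = a"
      by (simp add: numeral_2_eq_2)
    \<comment> \<open>Cancelling two reflections turns the relation into commutation evaluated at
      \<open>a\<close>.\<close>
    from arg_cong[OF this, of "\<lambda>y. reflection b (reflection a y)"]
    have "reflection a (reflection b a) = reflection b (reflection a a)"
      by (simp add: reflection_involution)
    then have "reflection a (reflection b a) = - reflection b a"
      by (simp add: reflection_self linear_neg[OF linear_reflection])
    then have "reflection b a \<in> span {a}" by (rule reflection_eq_minus_in_span)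
    then have "a - reflection b a \<in> span {a}" by (simp add: span_diff span_base)
    then have "(2 * (b \<bullet> a) / (b \<bullet> b)) *\<^sub>R b \<in> span {a}" by (simp add: reflection_def)
    then have "2 * (b \<bullet> a) / (b \<bullet> b) = 0"
      using indep span_scale_cancel by blast
    then show ?thesis using root_nonzero[OF S_root[OF assms(2)]] by (simp add: inner_commute)
  qed
qed

lemma component_subset: "C \<in> coxeter_components S \<Longrightarrow> C \<subseteq> S"
  unfolding coxeter_components_def by (auto elim!: quotientE)

lemma component_orthogonal:
  assumes "C \<in> coxeter_components S" "a \<in> C" "b \<in> S - C"
  shows "a \<bullet> b = 0"
proof (rule nonadjacent_orthogonal)
  obtain x where x: "x \<in> S" "C = ((coxeter_edges S)\<^sup>* \<inter> S \<times> S) `` {x}"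
    using assms(1) unfolding coxeter_components_def by (auto elim!: quotientE)
  show "(a, b) \<notin> coxeter_edges S"
  proof
    assume "(a, b) \<in> coxeter_edges S"
    then have "(x, b) \<in> (coxeter_edges S)\<^sup>*" using assms(2) x by (auto intro: rtrancl_into_rtrancl)
    then show False using assms(3) x by auto
  qed
qed (use assms component_subset in auto)

lemma exists_component: "b \<in> S \<Longrightarrow> \<exists>C\<in>coxeter_components S. b \<in> C"
  unfolding coxeter_components_def by (intro bexI[OF _ quotientI]) auto

subsection \<open>The quadratic condition\<close>

text \<open>The map \<open>E\<close> of the overview: pairing it with \<open>v\<close> gives the sum
  in the theorem. \<open>C\<close> may be any set of real vectors, since images of \<open>S\<close>
  under \<open>W\<close> also occur.\<close>

definition root_operator :: "(real ^ 'n) set \<Rightarrow> complex ^ 'n \<Rightarrow> complex ^ 'n" where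
  "root_operator C x = (\<Sum>a\<in>{a \<in> R. a \<in> span C}.
     (c a * scalar_product (cvec a) x / of_real (a \<bullet> a)) *s cvec a)"

lemma root_operator_add: "root_operator C (x + y) = root_operator C x + root_operator C y"
  by (simp add: root_operator_def scalar_product_right_simps distrib_left add_divide_distrib
      vec.scale_left_distrib sum.distrib)

lemma root_operator_scale: "root_operator C (k *s x) = k *s root_operator C x"
  by (simp add: root_operator_def scalar_product_right_simps vec.scale_sum_right mult.left_commute)

lemma root_operator_zero: "root_operator C 0 = 0"
  using root_operator_scale[of C 0 0] by simp

lemma scalar_product_root_operator:
  "scalar_product y (root_operator C x) = (\<Sum>a\<in>{a \<in> R. a \<in> span C}.
     c a * scalar_product (cvec a) x * scalar_product (cvec a) y / of_real (a \<bullet> a))"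
  by (simp add: root_operator_def scalar_product_right_simps scalar_product_commute[of y])

text \<open>Self-adjointness will move the operator from \<open>\<xi>\<close> onto the roots cutting
  out a component of the stratum.\<close>

lemma root_operator_symmetric:
  "scalar_product y (root_operator C x) = scalar_product x (root_operator C y)"
  by (simp add: scalar_product_root_operator mult.assoc mult.commute[of "scalar_product _ x"])

lemma root_operator_in_span: "root_operator C x \<in> vec.span (cvec ` C)"
  unfolding root_operator_def
  by (intro vec.span_sum vec.span_scale) (simp add: cvec_in_span_iff)

text \<open>\<open>w\<close> permutes the roots and preserves their lengths and \<open>c\<close>.
  Thus the condition for \<open>\<pi>\<close> carries over to every component
  \<open>w \<pi>\<close>.\<close>

lemma root_operator_image:
  assumes w: "w \<in> W"
  shows "root_operator (w ` C) (complexify w x) = complexify w (root_operator C x)"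
proof -
  have "{a \<in> R. a \<in> span (w ` C)} = w ` {a \<in> R. a \<in> span C}"
    unfolding linear_span_image[OF linear_W[OF w]]
  proof safe
    fix y assume "w y \<in> R" "y \<in> span C"
    then have "inv w (w y) \<in> R" using W_root inv_in_W w by blast
    then have "y \<in> R" using inj_W[OF w] by simp
    then show "w y \<in> w ` {a \<in> R. a \<in> span C}" using \<open>y \<in> span C\<close> by blast
  qed (use W_root w in auto)
  moreover have "inj_on w A" for A using inj_W[OF w] inj_on_subset by blast
  moreover have "w a \<bullet> w a = a \<bullet> a" for a
    using orthogonal_W[OF w] by (simp add: orthogonal_transformation_def)
  ultimately show ?thesis
    by (simp add: root_operator_def sum.reindex complexify_sum complexify_scale complexify_cvec
        linear_W w complexify_orthogonal orthogonal_W)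
      (auto intro!: sum.cong simp: c_invariant w)
qed

text \<open>A root of \<open>span S\<close> outside \<open>span C\<close> lies in the span of the
  other components, so it is orthogonal to \<open>b\<close> and contributes nothing.\<close>

lemma root_operator_component:
  assumes C: "C \<in> coxeter_components S" and b: "b \<in> C"
  shows "root_operator S (cvec b) = root_operator C (cvec b)"
  unfolding root_operator_def
proof (rule sum.mono_neutral_right)
  show "finite {a \<in> R. a \<in> span S}" using finite_R by simp
  show "{a \<in> R. a \<in> span C} \<subseteq> {a \<in> R. a \<in> span S}"
    using span_mono[OF component_subset[OF C]] by blast
  show "\<forall>a\<in>{a \<in> R. a \<in> span S} - {a \<in> R. a \<in> span C}.
      (c a * scalar_product (cvec a) (cvec b) / of_real (a \<bullet> a)) *s cvec a = 0"
  proof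
    fix a assume a: "a \<in> {a \<in> R. a \<in> span S} - {a \<in> R. a \<in> span C}"
    then have "a \<in> span (S - C)"
      using root_in_summand[OF component_subset[OF C] component_orthogonal[OF C]] by blast
    then have "a \<bullet> b = 0"
      by (rule inner_span_eq_0[rotated])
        (use component_orthogonal[OF C b] in \<open>simp add: inner_commute[of _ b]\<close>)
    then show "(c a * scalar_product (cvec a) (cvec b) / of_real (a \<bullet> a)) *s cvec a = 0"
      by (simp add: scalar_product_cvec)
  qed
qed

text \<open>Each sum is \<open>(v, E u)\<close>, so nondegeneracy on the span of a component turns
  the condition into \<open>E b = b\<close> for its simple roots. Linearity gives the
  converse.\<close>

lemma component_condition_iff:
  "(\<forall>C\<in>coxeter_components S.
      \<forall>u\<in>vec.span (cvec ` C). \<forall>v\<in>vec.span (cvec ` C).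
        (\<Sum>a\<in>{a \<in> R. cvec a \<in> vec.span (cvec ` C)}.
           c a * scalar_product (cvec a) u * scalar_product (cvec a) v
             / scalar_product (cvec a) (cvec a))
        = scalar_product u v) \<longleftrightarrow>
   (\<forall>b\<in>S. root_operator S (cvec b) = cvec b)" (is "?L \<longleftrightarrow> ?R")
proof -
  have sum_eq: "(\<Sum>a\<in>{a \<in> R. cvec a \<in> vec.span (cvec ` C)}.
      c a * scalar_product (cvec a) u * scalar_product (cvec a) v
        / scalar_product (cvec a) (cvec a)) = scalar_product v (root_operator C u)" for C u v
    by (simp add: scalar_product_root_operator cvec_in_span_iff scalar_product_cvec)
  show ?thesis
    unfolding sum_eq
  proof (intro iffI ballI)
    fix b assume L: "\<forall>C\<in>coxeter_components S. \<forall>u\<in>vec.span (cvec ` C). \<forall>v\<in>vec.span (cvec ` C).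
      scalar_product v (root_operator C u) = scalar_product u v" and "b \<in> S"
    then obtain C where C: "C \<in> coxeter_components S" "b \<in> C" using exists_component by blast
    then have b: "cvec b \<in> vec.span (cvec ` C)" by (simp add: vec.span_base)
    have "root_operator C (cvec b) - cvec b = 0"
    proof (rule span_cvec_nondegenerate)
      show "root_operator C (cvec b) - cvec b \<in> vec.span (cvec ` C)"
        using root_operator_in_span b by (rule vec.span_diff)
      fix d assume "d \<in> C"
      then have "cvec d \<in> vec.span (cvec ` C)" by (simp add: vec.span_base)
      then show "scalar_product (cvec d) (root_operator C (cvec b) - cvec b) = 0"
        using L C(1) b by (simp add: scalar_product_right_simps scalar_product_commute)
    qed
    then show "root_operator S (cvec b) = cvec b" using root_operator_component[OF C] by simp
  next
    fix C u v assume R: ?R and C: "C \<in> coxeter_components S"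
      and u: "u \<in> vec.span (cvec ` C)"
    have "root_operator C u = u"
      using u
    proof (induction rule: vec.span_induct_alt)
      case (step k x y)
      then obtain b where b: "b \<in> C" "x = cvec b" by blast
      then have "root_operator S x = x" using R component_subset[OF C] by blast
      then have "root_operator C x = x" using root_operator_component[OF C] b by simp
      then show ?case using step by (simp add: root_operator_add root_operator_scale)
    qed (rule root_operator_zero)
    then show "scalar_product v (root_operator C u) = scalar_product u v"
      by (simp add: scalar_product_commute)
  qed
qed

subsection \<open>The Dunkl operators on the parabolic ideal\<close>

text \<open>Orthogonality moves \<open>w\<close> from points to roots: \<open>w \<pi>\<close> is cut
  out by the forms of the vectors \<open>w b\<close>.\<close>

lemma parabolic_stratum_iff:
  "x \<in> parabolic_stratum W S \<longleftrightarrow> (\<exists>w\<in>W. \<forall>b\<in>S. scalar_product (cvec (w b)) x = 0)"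
proof
  assume "x \<in> parabolic_stratum W S"
  then obtain w y where "w \<in> W" "x = complexify w y" "\<forall>b\<in>S. scalar_product (cvec b) y = 0"
    unfolding parabolic_stratum_def by blast
  then show "\<exists>w\<in>W. \<forall>b\<in>S. scalar_product (cvec (w b)) x = 0"
    by (auto intro!: bexI[of _ w] simp: complexify_orthogonal orthogonal_W)
next
  assume "\<exists>w\<in>W. \<forall>b\<in>S. scalar_product (cvec (w b)) x = 0"
  then obtain w where w: "w \<in> W" "\<forall>b\<in>S. scalar_product (cvec (w b)) x = 0" by blast
  let ?y = "complexify (inv w) x"
  have "scalar_product (cvec b) ?y = 0" if "b \<in> S" for b
    using w that complexify_orthogonal[OF orthogonal_W[OF w(1)], of b ?y]
    by (simp add: complexify_W_inv)
  then have "complexify w ?y \<in> parabolic_stratum W S"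
    using w(1) unfolding parabolic_stratum_def by blast
  then show "x \<in> parabolic_stratum W S" using w(1) by (simp add: complexify_W_inv)
qed

lemma complexify_parabolic_stratum:
  assumes "v \<in> W" "x \<in> parabolic_stratum W S"
  shows "complexify v x \<in> parabolic_stratum W S"
proof -
  obtain w where w: "w \<in> W" "\<forall>b\<in>S. scalar_product (cvec (w b)) x = 0"
    using assms(2) parabolic_stratum_iff by blast
  then have "\<forall>b\<in>S. scalar_product (cvec ((v \<circ> w) b)) (complexify v x) = 0"
    using assms(1) by (simp add: complexify_orthogonal orthogonal_W)
  then show ?thesis unfolding parabolic_stratum_iff using comp_in_W[OF assms(1) w(1)] by blast
qed

lemma parabolic_ideal_polys: "p \<in> parabolic_ideal W S \<Longrightarrow> p \<in> polys"
  by (simp add: parabolic_ideal_def)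

lemma parabolic_ideal_zero:
  assumes "p \<in> parabolic_ideal W S" "w \<in> W" "\<And>b. b \<in> S \<Longrightarrow> scalar_product (cvec (w b)) x = 0"
  shows "p x = 0"
  using assms parabolic_stratum_iff unfolding parabolic_ideal_def by blast

lemma act_parabolic_ideal:
  assumes "w \<in> W" "p \<in> parabolic_ideal W S"
  shows "act w p \<in> parabolic_ideal W S"
  using assms complexify_parabolic_stratum[OF inv_in_W] polys_complexify[OF linear_W[OF inv_in_W]]
  by (auto simp: parabolic_ideal_def act_def[abs_def])

text \<open>For roots not vanishing on the component \<open>w \<pi>\<close> of the stratum, both \<open>p\<close> and \<open>s\<^sub>a p\<close> vanish
  on \<open>w \<pi>\<close>, hence so does the quotient off the mirror and, by continuity, everywhere on \<open>w \<pi>\<close>.\<close>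

lemma divided_difference_on_stratum:
  assumes p: "p \<in> parabolic_ideal W S" and w: "w \<in> W"
    and x: "\<And>b. b \<in> S \<Longrightarrow> scalar_product (cvec (w b)) x = 0" and a: "a \<in> R"
  shows "divided_difference a p x =
    (if a \<in> span (w ` S) then 2 * scalar_product (gradient p x) (cvec a) / of_real (a \<bullet> a) else 0)"
proof (cases "a \<in> span (w ` S)")
  case True
  then have "scalar_product (cvec a) x = 0"
    using x scalar_product_span_cvec_eq_0[of "w ` S"] by blast
  then show ?thesis
    using True divided_difference_on_mirror parabolic_ideal_polys[OF p] root_nonzero[OF a] by simp
next
  case False
  note pd = parabolic_ideal_polys[OF p] root_nonzero[OF a]
  obtain y where y: "\<forall>b\<in>w ` S. b \<bullet> y = 0" "a \<bullet> y \<noteq> 0"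
    using exists_orthogonal_not[OF False] by blast
  have "divided_difference a p x = 0"
  proof (rule polys_zero_by_line[OF polys_divided_difference[OF pd], of "of_real (a \<bullet> y)" "cvec a" x "cvec y"])
    fix t assume t: "scalar_product (cvec a) x + t * of_real (a \<bullet> y) \<noteq> 0"
    let ?x = "x + t *s cvec y"
    have nz: "scalar_product (cvec a) ?x \<noteq> 0"
      using t by (simp add: scalar_product_right_simps scalar_product_cvec)
    have "\<forall>b\<in>S. scalar_product (cvec (w b)) ?x = 0"
      using x y(1) by (simp add: scalar_product_right_simps scalar_product_cvec)
    then have "?x \<in> parabolic_stratum W S" using w parabolic_stratum_iff by blast
    moreover from this have "complexify (reflection a) ?x \<in> parabolic_stratum W S"
      using complexify_parabolic_stratum reflection_in_W a by blast
    ultimately have "p ?x - act (reflection a) p ?x = 0"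
      using p by (simp add: parabolic_ideal_def act_reflection)
    then show "divided_difference a p ?x = 0"
      using nz divided_difference_mult[OF pd, of ?x] by simp
  qed (use y in simp)
  then show ?thesis using False by simp
qed

text \<open>Only roots vanishing on \<open>w \<pi>\<close> contribute, each through a normal
  derivative. Passing from positive to all roots absorbs the 2 and leaves the gradient paired with
  \<open>E \<xi>\<close>.\<close>

lemma dunkl_on_stratum:
  assumes p: "p \<in> parabolic_ideal W S" and w: "w \<in> W"
    and x: "\<And>b. b \<in> S \<Longrightarrow> scalar_product (cvec (w b)) x = 0"
  shows "dunkl P c \<xi> p x = scalar_product (gradient p x) (\<xi> - root_operator (w ` S) \<xi>)"
proof -
  let ?g = "gradient p x" and ?V = "span (w ` S)"
  let ?f = "\<lambda>a. c a * scalar_product (cvec a) \<xi> * scalar_product (cvec a) ?g / of_real (a \<bullet> a)"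
  have neg: "scalar_product (cvec (- a)) y = - scalar_product (cvec a) y" for a and y :: "complex ^ 'n"
    by (simp add: scalar_product_def cvec_def sum_negf)
  have "(\<Sum>a\<in>P. c a * scalar_product (cvec a) \<xi> * divided_difference a p x) =
      (\<Sum>a\<in>P. if a \<in> ?V then 2 * ?f a else 0)"
    using P_subset divided_difference_on_stratum[OF p w x]
    by (intro sum.cong) (auto simp: scalar_product_commute[of ?g])
  also have "\<dots> = 2 * (\<Sum>a\<in>{a \<in> P. a \<in> ?V}. ?f a)"
    using finite_P by (simp add: sum_distrib_left flip: sum.inter_filter)
  also have "\<dots> = (\<Sum>a\<in>{a \<in> R. a \<in> ?V}. ?f a)"
    by (rule sum_roots_eq_twice_positive[symmetric]) (simp add: neg c_minus)
  also have "\<dots> = scalar_product ?g (root_operator (w ` S) \<xi>)"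
    by (simp add: scalar_product_root_operator)
  finally show ?thesis
    by (simp add: dunkl_def dir_deriv_eq parabolic_ideal_polys[OF p] scalar_product_diff_right)
qed

lemma polys_dunkl:
  assumes "p \<in> polys"
  shows "dunkl P c \<xi> p \<in> polys"
  unfolding dunkl_def
  using P_subset root_nonzero
  by (intro polys_diff polys_dir_deriv polys_sum polys_cmult polys_divided_difference assms) auto

text \<open>Multiplications preserve an ideal, \<open>W\<close> preserves the stratum, and
  invariance passes to sums and compositions; only the Dunkl operators remain.\<close>

lemma cherednik_invariant_iff:
  "cherednik_invariant W P c (parabolic_ideal W S) \<longleftrightarrow>
    (\<forall>\<xi>. \<forall>p\<in>parabolic_ideal W S. dunkl P c \<xi> p \<in> parabolic_ideal W S)"
proof
  assume "cherednik_invariant W P c (parabolic_ideal W S)"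
  then show "\<forall>\<xi>. \<forall>p\<in>parabolic_ideal W S. dunkl P c \<xi> p \<in> parabolic_ideal W S"
    using cherednik.dunkl[of P c _ W] unfolding cherednik_invariant_def by blast
next
  assume preserved: "\<forall>\<xi>. \<forall>p\<in>parabolic_ideal W S. dunkl P c \<xi> p \<in> parabolic_ideal W S"
  have "T p \<in> parabolic_ideal W S" if "T \<in> cherednik W P c" "p \<in> parabolic_ideal W S" for T p
    using that
  proof (induction arbitrary: p rule: cherednik.induct)
    case (poly f)
    then show ?case by (simp add: parabolic_ideal_def polys.mult)
  next
    case (add T U)
    from add.IH[OF add.prems] show ?case by (simp add: parabolic_ideal_def polys.add)
  next
    case (group w)
    then show ?case by (intro act_parabolic_ideal)
  next
    case (dunkl \<xi>)
    then show ?case using preserved by blast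
  next
    case (comp T U)
    then show ?case by simp
  qed
  then show "cherednik_invariant W P c (parabolic_ideal W S)"
    unfolding cherednik_invariant_def by blast
qed

text \<open>Equivariance and self-adjointness make \<open>\<xi> - E \<xi>\<close> orthogonal to all
  \<open>w b\<close>. This direction is tangent to \<open>w \<pi>\<close>, where \<open>p\<close>
  vanishes, so the derivative is zero.\<close>

lemma cherednik_invariantI:
  assumes E: "\<And>b. b \<in> S \<Longrightarrow> root_operator S (cvec b) = cvec b"
  shows "cherednik_invariant W P c (parabolic_ideal W S)"
  unfolding cherednik_invariant_iff
proof (intro allI ballI)
  fix \<xi> p assume p: "p \<in> parabolic_ideal W S"
  have "dunkl P c \<xi> p x = 0" if "x \<in> parabolic_stratum W S" for x
  proof -
    obtain w where w: "w \<in> W" and "\<forall>b\<in>S. scalar_product (cvec (w b)) x = 0"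
      using \<open>x \<in> parabolic_stratum W S\<close> unfolding parabolic_stratum_iff by blast
    then have x: "scalar_product (cvec (w b)) x = 0" if "b \<in> S" for b using that by blast
    let ?\<eta> = "\<xi> - root_operator (w ` S) \<xi>"
    have \<eta>: "scalar_product (cvec (w b)) ?\<eta> = 0" if "b \<in> S" for b
    proof -
      have "root_operator (w ` S) (complexify w (cvec b)) = complexify w (cvec b)"
        by (simp only: root_operator_image[OF w] E[OF that])
      then have "root_operator (w ` S) (cvec (w b)) = cvec (w b)"
        by (simp only: complexify_cvec[OF linear_W[OF w]])
      then have "scalar_product (cvec (w b)) (root_operator (w ` S) \<xi>) = scalar_product \<xi> (cvec (w b))"
        by (subst root_operator_symmetric) simp
      then show ?thesis by (simp add: scalar_product_diff_right scalar_product_commute[of \<xi>])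
    qed
    have "p (x + t *s ?\<eta>) = 0" for t
      by (rule parabolic_ideal_zero[OF p w]) (simp only: scalar_product_right_simps(1,2) x \<eta> mult_zero_right add_0_left)
    then have "((\<lambda>t. 0) has_field_derivative scalar_product (gradient p x) ?\<eta>) (at (0::complex))"
      using has_derivative_gradient[OF parabolic_ideal_polys[OF p], of x ?\<eta>] by simp
    then have "scalar_product (gradient p x) ?\<eta> = 0" by (rule DERIV_unique) simp
    then show ?thesis using dunkl_on_stratum[OF p w x] by simp
  qed
  then show "dunkl P c \<xi> p \<in> parabolic_ideal W S"
    using polys_dunkl parabolic_ideal_polys[OF p] by (simp add: parabolic_ideal_def)
qed

text \<open>A polynomial of the ideal with derivative at a generic point \<open>x\<close> of \<open>\<pi>\<close> in a direction
  \<open>\<eta>\<close> transversal to \<open>\<pi>\<close>: a linear form vanishing on \<open>\<pi>\<close>, times one linear form for each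
  \<open>w\<close> with \<open>w \<pi> \<noteq> \<pi>\<close>, vanishing on \<open>w \<pi>\<close> but not at \<open>x\<close>.\<close>

lemma exists_transversal_poly:
  assumes b0: "b0 \<in> S" and \<eta>: "scalar_product (cvec b0) \<eta> \<noteq> 0"
  shows "\<exists>p\<in>parabolic_ideal W S. \<exists>x. (\<forall>b\<in>S. scalar_product (cvec b) x = 0) \<and>
    scalar_product (gradient p x) \<eta> \<noteq> 0"
proof -
  define B where "B = {w \<in> W. \<not> w ` S \<subseteq> span S}"
  have finite_B: "finite B" using finite_W by (simp add: B_def)
  have "\<forall>w\<in>B. \<exists>b. b \<in> S \<and> w b \<notin> span S" by (auto simp: B_def)
  then obtain \<beta> where \<beta>: "\<And>w. w \<in> B \<Longrightarrow> \<beta> w \<in> S" "\<And>w. w \<in> B \<Longrightarrow> w (\<beta> w) \<notin> span S"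
    by metis
  \<comment> \<open>A real point of \<open>\<pi>\<close> off the hyperplanes of the finitely many
    chosen roots, so that the product \<open>f\<close> below is nonzero there.\<close>
  obtain y where y: "\<forall>b\<in>S. b \<bullet> y = 0" "\<forall>a\<in>(\<lambda>w. w (\<beta> w)) ` B. a \<bullet> y \<noteq> 0"
    using exists_orthogonal_generic[of "(\<lambda>w. w (\<beta> w)) ` B" S] finite_B \<beta>(2) by auto
  define f where "f x = (\<Prod>w\<in>B. scalar_product (cvec (w (\<beta> w))) x)" for x
  define p where "p x = scalar_product (cvec b0) x * f x" for x
  have f: "f \<in> polys" unfolding f_def[abs_def] by (intro polys_prod polys_scalar_product)
  have p: "p \<in> polys" unfolding p_def[abs_def] by (intro polys.mult polys_scalar_product f)
  have "p x = 0" if "x \<in> parabolic_stratum W S" for x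
  proof -
    obtain w where w: "w \<in> W" and "\<forall>b\<in>S. scalar_product (cvec (w b)) x = 0"
      using \<open>x \<in> parabolic_stratum W S\<close> unfolding parabolic_stratum_iff by blast
    then have x: "scalar_product (cvec (w b)) x = 0" if "b \<in> S" for b using that by blast
    show ?thesis
    proof (cases "w \<in> B")
      case True
      then have "f x = 0" unfolding f_def using finite_B x \<beta>(1) by (auto intro: prod_zero)
      then show ?thesis by (simp add: p_def)
    next
      case False
      then have sub: "w ` S \<subseteq> span S" using w by (auto simp: B_def)
      \<comment> \<open>An injective linear map preserves dimension, so the inclusion forces
        equality of spans. Thus \<open>w\<close> stabilises \<open>\<pi>\<close>, and the form of
        \<open>b0\<close> vanishes on \<open>w \<pi>\<close>.\<close>
      have "dim (w ` S) = dim S"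
        using linear_W[OF w] inj_W[OF w] by (intro dim_image_eq) (auto intro: inj_on_subset)
      then have "span (w ` S) = span (span S)" using sub by (intro dim_eq_span) simp_all
      then have "b0 \<in> span (w ` S)" using b0 by (simp add: span_base)
      then have "scalar_product (cvec b0) x = 0"
        using x scalar_product_span_cvec_eq_0[of "w ` S"] by blast
      then show ?thesis by (simp add: p_def)
    qed
  qed
  then have pI: "p \<in> parabolic_ideal W S" using p by (simp add: parabolic_ideal_def)
  let ?x = "cvec y"
  have x: "scalar_product (cvec b) ?x = 0" if "b \<in> S" for b
    using y(1) that by (simp add: scalar_product_cvec)
  have fx: "f ?x \<noteq> 0"
    using y(2) finite_B by (simp add: f_def scalar_product_cvec)
  have p_line: "p (?x + t *s \<eta>) = t * scalar_product (cvec b0) \<eta> * f (?x + t *s \<eta>)" for t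
    by (simp add: p_def scalar_product_right_simps x[OF b0])
  \<comment> \<open>The linear factor vanishes at \<open>?x\<close>, so only the term that
    differentiates it survives at \<open>t = 0\<close>.\<close>
  have "((\<lambda>t. t * scalar_product (cvec b0) \<eta> * f (?x + t *s \<eta>)) has_field_derivative
      scalar_product (cvec b0) \<eta> * f (?x + 0 *s \<eta>) +
      scalar_product (gradient f ?x) \<eta> * (0 * scalar_product (cvec b0) \<eta>)) (at 0)"
    by (intro DERIV_mult has_derivative_gradient f) (auto intro!: derivative_eq_intros)
  then have "scalar_product (gradient p ?x) \<eta> = scalar_product (cvec b0) \<eta> * f ?x"
    using has_derivative_gradient[OF p, of ?x \<eta>, unfolded p_line] DERIV_unique by fastforce
  then have "scalar_product (gradient p ?x) \<eta> \<noteq> 0" using \<eta> fx by simp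
  then show ?thesis using pI x by blast
qed

text \<open>If \<open>b - E b\<close> paired nontrivially with some \<open>b0\<close> in
  \<open>S\<close>, the transversal polynomial would have a Dunkl image that is nonzero at a point
  of \<open>\<pi>\<close>. As \<open>b - E b\<close> lies in the span of \<open>S\<close>,
  nondegeneracy makes it zero.\<close>

lemma cherednik_invariantD:
  assumes inv: "cherednik_invariant W P c (parabolic_ideal W S)" and b: "b \<in> S"
  shows "root_operator S (cvec b) = cvec b"
proof -
  let ?\<eta> = "cvec b - root_operator S (cvec b)"
  have "?\<eta> = 0"
  proof (rule span_cvec_nondegenerate)
    show "?\<eta> \<in> vec.span (cvec ` S)"
      using b root_operator_in_span by (simp add: vec.span_diff vec.span_base)
    fix b0 assume b0: "b0 \<in> S"
    show "scalar_product (cvec b0) ?\<eta> = 0"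
    proof (rule ccontr)
      assume "scalar_product (cvec b0) ?\<eta> \<noteq> 0"
      then obtain p x where p: "p \<in> parabolic_ideal W S"
        and x: "\<And>b. b \<in> S \<Longrightarrow> scalar_product (cvec b) x = 0"
        and ne: "scalar_product (gradient p x) ?\<eta> \<noteq> 0"
        using exists_transversal_poly[OF b0] by blast
      \<comment> \<open>The component \<open>\<pi>\<close> itself is the case
        \<open>w = id\<close>.\<close>
      have x': "scalar_product (cvec (id d)) x = 0" if "d \<in> S" for d using x[OF that] by simp
      have "dunkl P c (cvec b) p \<in> parabolic_ideal W S"
        using inv p unfolding cherednik_invariant_iff by blast
      then have "dunkl P c (cvec b) p x = 0" using id_in_W x' by (rule parabolic_ideal_zero)
      then show False using ne dunkl_on_stratum[OF p id_in_W x'] by simp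
    qed
  qed
  then show ?thesis by simp
qed

end

theorem theorem1:
  fixes W :: "(real ^ 'n \<Rightarrow> real ^ 'n) set"
    and R P \<Delta> S :: "(real ^ 'n) set"
    and c :: "real ^ 'n \<Rightarrow> complex"
  assumes "finite_reflection_group W"
    and "root_system W R"
    and "positive_system R P"
    and "simple_system P \<Delta>"
    and "S \<subseteq> \<Delta>"
    and "\<And>w a. w \<in> W \<Longrightarrow> a \<in> R \<Longrightarrow> c (w a) = c a"
  shows "cherednik_invariant W P c (parabolic_ideal W S) \<longleftrightarrow>
    (\<forall>C\<in>coxeter_components S.
       \<forall>u\<in>vec.span (cvec ` C). \<forall>v\<in>vec.span (cvec ` C).
         (\<Sum>a\<in>{a \<in> R. cvec a \<in> vec.span (cvec ` C)}.
            c a * scalar_product (cvec a) u * scalar_product (cvec a) v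
              / scalar_product (cvec a) (cvec a))
         = scalar_product u v)"
proof -
  interpret reflection_group_setting W R P \<Delta> S c
    using assms by unfold_locales
  show ?thesis
    unfolding component_condition_iff
    using cherednik_invariantI cherednik_invariantD by blast
qed

end
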